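(* Let $N\ge1$ and let $M\subset\mathbb{C}^{N+1}$ be a real-formal submanifold of codimension $2$. Suppose that $0\in M$ is a CR singular point and that $M$ is defined by $$w=\langle z,z\rangle+\sum_{m+n\geq 3}\varphi_{m,n}(z,\overline{z}),$$ where $\varphi_{m,n}(z,\overline{z})$ is a bihomogeneous polynomial of bidegree $(m,n)$ in $(z,\overline{z})$, for all $m,n\geq 0$. Then there exists a unique formal map $$(z',w')=\Big(z+\sum_{m+n\geq 2}F_{m,n}(z)w^{n},\ w+\sum_{m+n\geq 2}G_{m,n}(z)w^{n}\Big),$$ where $F_{m,n}(z)$ ($\mathbb{C}^N$-valued) and $G_{m,n}(z)$ ($\mathbb{C}$-valued) are homogeneous polynomials in $z$ of degree $m$, with the normalization conditions $$F_{0,n+1}(z)=0,\quad F_{1,n}(z)=0,\quad\text{for all } n\geq 1,$$ that transforms $M$ to the partial normal form $$w'=\langle z',z'\rangle+\sum_{m+n\geq 3,\ m,n\neq 0}\varphi'_{m,n}(z',\overline{z'})+2\operatorname{Re}\Big\{\sum_{k\geq 3}\varphi'_{k,0}(z')\Big\},$$ where $\varphi'_{m,n}(z,\overline{z})$ are bihomogeneous polynomials of bidegree $(m,n)$ in $(z,\overline{z})$, for all $m,n\geq 0$ (with $\varphi'_{k,0}(z):=\varphi'_{k,0}(z,\overline z)$), that satisfy the trace normalization conditions $$\begin{cases}\operatorname{tr}^{m-1}\varphi'_{m,n}(z,\overline{z})=0, & m\leq n-1,\ m,n\neq 0,\\ \operatorname{tr}^{n}\varphi'_{m,n}(z,\overline{z})=0,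 & m\geq n,\ m,n\neq 0.\end{cases}$$
   Context: Coordinates on $\mathbb{C}^{N+1}$ are $(z,w)=(z_1,\dots,z_N,w)$, and $\langle z,t\rangle=z_1\overline t_1+\dots+z_N\overline t_N$ for $z,t\in\mathbb{C}^N$. A real-formal submanifold of codimension $2$ is given by an equation $w=\rho(z,\overline z)$ with $\rho$ a formal power series in $(z,\overline z)$ with complex coefficients ($z$ and $\overline z$ being treated as independent variables). A point $p\in M$ is a CR singularity if it is a jumping discontinuity point of the map $q\mapsto\dim_{\mathbb{C}}T^{0,1}_qM$ defined near $p$ on $M$, where $T^{0,1}_qM$ is the CR tangent space to $M$ at $q$. Bihomogeneous of bidegree $(m,n)$ means homogeneous of degree $m$ in $z$ and of degree $n$ in $\overline z$. A formal map $(z',w')=(F(z,w),G(z,w))$, with $F$ and $G$ formal power series in $(z,w)$ without constant term, transforms $M=\{w=\rho(z,\overline z)\}$ to $M'=\{w'=\rho'(z',\overline{z'})\}$ if $$G(z,\rho(z,\overline z))=\rho'\big(F(z,\rho(z,\overline z)),\overline{F(z,\rho(z,\overline z))}\big)$$ as formal power series in $(z,\overline z)$. The trace operator is $\operatorname{tr}:=\sum_{k=1}^{N}\frac{\partial^{2}}{\partial z_{k}\,\partial\overline{z}_{k}}$, $\operatorname{tr}^j$ is its $j$-th iterate, and $\operatorname{tr}^0$ is the identity. *)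

theory Defs
  imports "HOL-Analysis.Analysis" "HOL-Computational_Algebra.Fraction_Field"
begin

section \<open>Formal power series in finitely many variables\<close>

text \<open>The variables are the elements of a finite type \<open>'v\<close>, and a multi-index is a vector
  of type \<^typ>\<open>nat ^ 'v\<close>.\<close>

typedef ('v, 'a) mfps = "UNIV :: (nat ^ 'v \<Rightarrow> 'a) set"
  morphisms mcoeff Abs_mfps by simp

setup_lifting type_definition_mfps

lemma mfps_eqI: "(\<And>\<alpha>. mcoeff f \<alpha> = mcoeff g \<alpha>) \<Longrightarrow> f = g"
  by transfer auto

lemma finite_multi_index_le: "finite {\<beta> :: nat ^ 'v::finite. \<beta> \<le> \<alpha>}"
proof (rule finite_subset)
  show "{\<beta>. \<beta> \<le> \<alpha>} \<subseteq> vec_lambda ` PiE UNIV (\<lambda>v. {..\<alpha> $ v})"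
  proof
    fix \<beta> :: "nat ^ 'v" assume "\<beta> \<in> {\<beta>. \<beta> \<le> \<alpha>}"
    then have "vec_nth \<beta> \<in> PiE UNIV (\<lambda>v. {..\<alpha> $ v})"
      by (auto simp: less_eq_vec_def)
    then show "\<beta> \<in> vec_lambda ` PiE UNIV (\<lambda>v. {..\<alpha> $ v})"
      by (intro image_eqI[of _ _ "vec_nth \<beta>"]) simp_all
  qed
  show "finite (vec_lambda ` PiE UNIV (\<lambda>v. {..\<alpha> $ v}))"
    by (intro finite_imageI finite_PiE) auto
qed

lemma finite_multi_index_split: "finite {(\<beta>, \<gamma>). \<beta> + \<gamma> = (\<alpha> :: nat ^ 'v::finite)}"
  by (rule finite_subset[OF _ finite_cartesian_product[OF finite_multi_index_le[of \<alpha>] finite_multi_index_le[of \<alpha>]]])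
     (auto simp: less_eq_vec_def)

instantiation mfps :: (finite, comm_ring_1) comm_ring_1
begin

lift_definition zero_mfps :: "('a, 'b) mfps" is "\<lambda>_. 0" .
lift_definition one_mfps :: "('a, 'b) mfps" is "\<lambda>\<alpha>. if \<alpha> = 0 then 1 else 0" .
lift_definition plus_mfps :: "('a, 'b) mfps \<Rightarrow> ('a, 'b) mfps \<Rightarrow> ('a, 'b) mfps"
  is "\<lambda>f g \<alpha>. f \<alpha> + g \<alpha>" .
lift_definition uminus_mfps :: "('a, 'b) mfps \<Rightarrow> ('a, 'b) mfps" is "\<lambda>f \<alpha>. - f \<alpha>" .
lift_definition minus_mfps :: "('a, 'b) mfps \<Rightarrow> ('a, 'b) mfps \<Rightarrow> ('a, 'b) mfps"
  is "\<lambda>f g \<alpha>. f \<alpha> - g \<alpha>" .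
lift_definition times_mfps :: "('a, 'b) mfps \<Rightarrow> ('a, 'b) mfps \<Rightarrow> ('a, 'b) mfps"
  is "\<lambda>f g \<alpha>. \<Sum>(\<beta>, \<gamma>) | \<beta> + \<gamma> = \<alpha>. f \<beta> * g \<gamma>" .

instance
proof
  fix f g h :: "('a, 'b) mfps"
  show "f * g * h = f * (g * h)"
  proof (transfer, rule ext)
    fix f g h :: "nat ^ 'a \<Rightarrow> 'b" and \<alpha> :: "nat ^ 'a"
    let ?S = "\<lambda>\<alpha> :: nat ^ 'a. {(\<beta>, \<gamma>). \<beta> + \<gamma> = \<alpha>}"
    have "(\<Sum>(\<delta>, c)\<in>?S \<alpha>. (\<Sum>(a, b)\<in>?S \<delta>. f a * g b) * h c) =
          (\<Sum>(p, q)\<in>(SIGMA p:?S \<alpha>. ?S (fst p)). f (fst q) * g (snd q) * h (snd p))"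
      by (subst sum.Sigma[symmetric])
         (auto simp: finite_multi_index_split finite_multi_index_split[unfolded case_prod_unfold] sum_distrib_right case_prod_unfold intro!: sum.cong)
    also have "\<dots> = (\<Sum>(p, q)\<in>(SIGMA p:?S \<alpha>. ?S (snd p)). f (fst p) * g (fst q) * h (snd q))"
      by (rule sum.reindex_bij_witness[of _
            "\<lambda>((a, d), (b, c)). ((a + b, c), (a, b))"
            "\<lambda>((d, c), (a, b)). ((a, b + c), (b, c))"])
         (auto simp: add.assoc)
    also have "\<dots> = (\<Sum>(a, \<delta>)\<in>?S \<alpha>. f a * (\<Sum>(b, c)\<in>?S \<delta>. g b * h c))"
      by (subst sum.Sigma[symmetric])
         (auto simp: finite_multi_index_split finite_multi_index_split[unfolded case_prod_unfold] sum_distrib_left case_prod_unfold mult.assoc intro!: sum.cong)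
    finally show "(\<Sum>(\<delta>, c)\<in>?S \<alpha>. (\<Sum>(a, b)\<in>?S \<delta>. f a * g b) * h c) =
                  (\<Sum>(a, \<delta>)\<in>?S \<alpha>. f a * (\<Sum>(b, c)\<in>?S \<delta>. g b * h c))" .
  qed
  show "f * g = g * f"
    by (transfer, rule ext, rule sum.reindex_bij_witness[of _ prod.swap prod.swap])
       (auto simp: add.commute mult.commute)
  show "1 * f = f"
  proof (transfer, rule ext)
    fix f :: "nat ^ 'a \<Rightarrow> 'b" and \<alpha> :: "nat ^ 'a"
    have "(\<Sum>(\<beta>, \<gamma>) | \<beta> + \<gamma> = \<alpha>. (if \<beta> = 0 then 1 else 0) * f \<gamma>) =
          (\<Sum>(\<beta>, \<gamma>) \<in> {(0 :: nat ^ 'a, \<alpha>)}. (if \<beta> = 0 then 1 else 0) * f \<gamma>)"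
      by (rule sum.mono_neutral_right) (auto simp: finite_multi_index_split split: if_splits)
    then show "(\<Sum>(\<beta>, \<gamma>) | \<beta> + \<gamma> = \<alpha>. (if \<beta> = 0 then 1 else 0) * f \<gamma>) = f \<alpha>"
      by simp
  qed
  show "(f + g) * h = f * h + g * h"
    by (transfer, rule ext) (simp add: distrib_right sum.distrib case_prod_unfold)
  show "(0 :: ('a, 'b) mfps) \<noteq> 1"
    by transfer (auto simp: fun_eq_iff)
  show "f + g + h = f + (g + h)" by transfer (simp add: add.assoc)
  show "f + g = g + f" by transfer (simp add: add.commute)
  show "0 + f = f" by transfer simp
  show "- f + f = 0" by transfer simp
  show "f - g = f + - g" by transfer simp
qed

end

text \<open>Nonzero series multiply to a nonzero series: given nonempty sets of multi-indices \<open>A\<close>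
  and \<open>B\<close> (the supports), minimising one coordinate after the other leaves a single pair whose
  sum is attained only once in \<open>A + B\<close>.\<close>

lemma multi_index_minimal_pair:
  fixes A B :: "(nat ^ 'v::finite) set"
  assumes "A \<noteq> {}" "B \<noteq> {}"
  shows "\<exists>a\<in>A. \<exists>b\<in>B. \<forall>a'\<in>A. \<forall>b'\<in>B. a' + b' = a + b \<longrightarrow> a' = a \<and> b' = b"
proof -
  define P where "P V A' B' \<longleftrightarrow> A' \<noteq> {} \<and> B' \<noteq> {} \<and> A' \<subseteq> A \<and> B' \<subseteq> B \<and>
      (\<forall>a\<in>A'. \<forall>a'\<in>A'. \<forall>v\<in>V. a $ v = a' $ v) \<and> (\<forall>b\<in>B'. \<forall>b'\<in>B'. \<forall>v\<in>V. b $ v = b' $ v) \<and>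
      (\<forall>a\<in>A'. \<forall>b\<in>B'. \<forall>a'\<in>A. \<forall>b'\<in>B. a' + b' = a + b \<longrightarrow> a' \<in> A' \<and> b' \<in> B')"
    for V :: "'v set" and A' B'
  have "\<exists>A' B'. P V A' B'" if "finite V" for V
    using that
  proof induction
    case empty
    have "P {} A B" using assms by (simp add: P_def)
    then show ?case by blast
  next
    case (insert v V)
    from insert.IH obtain A' B' where P: "P V A' B'" by blast
    have ne: "A' \<noteq> {}" "B' \<noteq> {}" using P by (simp_all add: P_def)
    obtain a0 where a0: "a0 \<in> A'" "\<And>a. a \<in> A' \<Longrightarrow> a0 $ v \<le> a $ v"
      using ne(1) ex_has_least_nat[of "\<lambda>a. a \<in> A'" _ "\<lambda>a. a $ v"] by blast
    obtain b0 where b0: "b0 \<in> B'" "\<And>b. b \<in> B' \<Longrightarrow> b0 $ v \<le> b $ v"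
      using ne(2) ex_has_least_nat[of "\<lambda>b. b \<in> B'" _ "\<lambda>b. b $ v"] by blast
    let ?A = "{a \<in> A'. a $ v = a0 $ v}" and ?B = "{b \<in> B'. b $ v = b0 $ v}"
    have *: "a' \<in> ?A \<and> b' \<in> ?B"
      if *: "a \<in> ?A" "b \<in> ?B" "a' \<in> A" "b' \<in> B" "a' + b' = a + b" for a b a' b'
    proof -
      have "a \<in> A'" "b \<in> B'" using * by simp_all
      then have 1: "a' \<in> A'" "b' \<in> B'" using P *(3-5) unfolding P_def by blast+
      have "a' $ v + b' $ v = a $ v + b $ v"
        using arg_cong[OF *(5), of "\<lambda>x. x $ v"] by simp
      moreover have "a0 $ v \<le> a' $ v" "b0 $ v \<le> b' $ v" using 1 a0(2) b0(2) by blast+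
      moreover have "a $ v = a0 $ v" "b $ v = b0 $ v" using * by simp_all
      ultimately have "a' $ v = a0 $ v" "b' $ v = b0 $ v" by linarith+
      then show ?thesis using 1 by simp
    qed
    have "P (insert v V) ?A ?B"
      unfolding P_def
    proof (intro conjI)
      show "?A \<noteq> {}" "?B \<noteq> {}" using a0(1) b0(1) by blast+
      show "?A \<subseteq> A" "?B \<subseteq> B" using P unfolding P_def by blast+
      have "\<forall>a\<in>A'. \<forall>a'\<in>A'. \<forall>v\<in>V. a $ v = a' $ v" "\<forall>b\<in>B'. \<forall>b'\<in>B'. \<forall>v\<in>V. b $ v = b' $ v"
        using P unfolding P_def by blast+
      then show "\<forall>a\<in>?A. \<forall>a'\<in>?A. \<forall>v\<in>insert v V. a $ v = a' $ v"
        "\<forall>b\<in>?B. \<forall>b'\<in>?B. \<forall>v\<in>insert v V. b $ v = b' $ v" by simp_all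
      show "\<forall>a\<in>?A. \<forall>b\<in>?B. \<forall>a'\<in>A. \<forall>b'\<in>B. a' + b' = a + b \<longrightarrow> a' \<in> ?A \<and> b' \<in> ?B"
        by (intro ballI impI) (rule *)
    qed
    then show ?case by blast
  qed
  from this[OF finite, of UNIV] obtain A' B' where P: "P UNIV A' B'" by blast
  then obtain a b where ab: "a \<in> A'" "b \<in> B'" "a \<in> A" "b \<in> B" unfolding P_def by blast
  have "a' = a \<and> b' = b" if "a' \<in> A" "b' \<in> B" "a' + b' = a + b" for a' b'
  proof -
    have 1: "a' \<in> A'" "b' \<in> B'" using P ab(1,2) that unfolding P_def by blast+
    have "a' $ v = a $ v" "b' $ v = b $ v" for v
      using P 1 ab(1,2) unfolding P_def by blast+
    then show ?thesis by (simp add: vec_eq_iff)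
  qed
  then show ?thesis using ab(3,4) by blast
qed

instance mfps :: (finite, idom) idom
proof
  fix f g :: "('a, 'b) mfps"
  assume "f \<noteq> 0" "g \<noteq> 0"
  then have "{\<alpha>. mcoeff f \<alpha> \<noteq> 0} \<noteq> {}" "{\<alpha>. mcoeff g \<alpha> \<noteq> 0} \<noteq> {}"
    by (auto intro!: mfps_eqI simp: zero_mfps.rep_eq)
  from multi_index_minimal_pair[OF this] obtain a b where ab:
    "mcoeff f a \<noteq> 0" "mcoeff g b \<noteq> 0"
    "\<And>a' b'. mcoeff f a' \<noteq> 0 \<Longrightarrow> mcoeff g b' \<noteq> 0 \<Longrightarrow> a' + b' = a + b \<Longrightarrow> a' = a \<and> b' = b"
    by auto
  have "mcoeff (f * g) (a + b) = (\<Sum>(\<beta>, \<gamma>) | \<beta> + \<gamma> = a + b. mcoeff f \<beta> * mcoeff g \<gamma>)"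
    by (simp add: times_mfps.rep_eq)
  also have "\<dots> = (\<Sum>(\<beta>, \<gamma>) \<in> {(a, b)}. mcoeff f \<beta> * mcoeff g \<gamma>)"
    by (rule sum.mono_neutral_right) (use ab(3) in \<open>auto simp: finite_multi_index_split\<close>)
  also have "\<dots> \<noteq> 0" using ab by simp
  finally show "f * g \<noteq> 0" by (auto simp: zero_mfps.rep_eq)
qed

lift_definition mconst :: "'a::comm_ring_1 \<Rightarrow> ('v::finite, 'a) mfps"
  is "\<lambda>c \<alpha>. if \<alpha> = 0 then c else 0" .

lift_definition mvar :: "'v::finite \<Rightarrow> ('v, 'a::comm_ring_1) mfps"
  is "\<lambda>v \<alpha>. if \<alpha> = axis v 1 then 1 else 0" .

text \<open>Formal partial derivative with respect to the variable \<open>v\<close>.\<close>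

lift_definition mderiv :: "'v::finite \<Rightarrow> ('v, 'a::comm_ring_1) mfps \<Rightarrow> ('v, 'a) mfps"
  is "\<lambda>v f \<alpha>. of_nat (\<alpha> $ v + 1) * f (\<alpha> + axis v 1)" .

text \<open>The formal sum of a locally finite family of series, i.e. one in which every multi-index has
  a nonzero coefficient in only finitely many members.  (Coefficients at multi-indices where this
  fails are set to \<open>0\<close>; all the sums used below are locally finite.)\<close>

lift_definition msum :: "'i set \<Rightarrow> ('i \<Rightarrow> ('v::finite, 'a::comm_ring_1) mfps) \<Rightarrow> ('v, 'a) mfps"
  is "\<lambda>I f \<alpha>. \<Sum>i | i \<in> I \<and> f i \<alpha> \<noteq> 0. f i \<alpha>" .

text \<open>The substitution \<open>f((g\<^sub>v)\<^sub>v) = \<Sum>\<^sub>\<alpha> f\<^sub>\<alpha> \<Prod>\<^sub>v g\<^sub>v\<^sup>\<alpha>\<^sup>v\<close>, meaningful whenever the series \<open>g\<^sub>v\<close> have no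
  constant term.\<close>

definition msubst ::
  "('v::finite, 'a::comm_ring_1) mfps \<Rightarrow> ('v \<Rightarrow> ('u::finite, 'a) mfps) \<Rightarrow> ('u, 'a) mfps" where
  "msubst f g = msum UNIV (\<lambda>\<alpha>. mconst (mcoeff f \<alpha>) * (\<Prod>v\<in>UNIV. g v ^ (\<alpha> $ v)))"

definition homogeneous :: "nat \<Rightarrow> ('v::finite, 'a::comm_ring_1) mfps \<Rightarrow> bool" where
  "homogeneous m f \<longleftrightarrow> (\<forall>\<alpha>. mcoeff f \<alpha> \<noteq> 0 \<longrightarrow> (\<Sum>v\<in>UNIV. \<alpha> $ v) = m)"


section \<open>Series in \<open>(z, conj z)\<close> and in \<open>(z, w)\<close>\<close>

text \<open>\<open>N\<close> is the cardinality of the index type \<open>'n\<close>.  In series in \<open>(z, conj z)\<close>, the variable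
  \<^term>\<open>Inl k\<close> is \<open>z\<^sub>k\<close> and \<^term>\<open>Inr k\<close> is the independent variable \<open>conj z\<^sub>k\<close>; in series in
  \<open>(z, w)\<close>, the variable \<^term>\<open>Some k\<close> is \<open>z\<^sub>k\<close> and \<^term>\<open>None\<close> is \<open>w\<close>.\<close>

type_synonym 'n z_series = "('n, complex) mfps"
type_synonym 'n zzbar_series = "('n + 'n, complex) mfps"
type_synonym 'n zw_series = "('n option, complex) mfps"

definition bihomogeneous :: "nat \<Rightarrow> nat \<Rightarrow> 'n::finite zzbar_series \<Rightarrow> bool" where
  "bihomogeneous m n f \<longleftrightarrow>
     (\<forall>\<alpha>. mcoeff f \<alpha> \<noteq> 0 \<longrightarrow> (\<Sum>k\<in>UNIV. \<alpha> $ Inl k) = m \<and> (\<Sum>k\<in>UNIV. \<alpha> $ Inr k) = n)"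

text \<open>Complex conjugation of a series in \<open>(z, conj z)\<close>: conjugate the coefficients and exchange
  the two groups of variables.\<close>

lift_definition mconj :: "'n::finite zzbar_series \<Rightarrow> 'n zzbar_series"
  is "\<lambda>f \<alpha>. cnj (f (\<chi> v. \<alpha> $ (case v of Inl k \<Rightarrow> Inr k | Inr k \<Rightarrow> Inl k)))" .

definition mRe :: "'n::finite zzbar_series \<Rightarrow> 'n zzbar_series" where
  "mRe f = mconst (1 / 2) * (f + mconj f)"

text \<open>The hermitian form \<open>\<langle>z, z\<rangle>\<close>.\<close>

definition herm :: "'n::finite zzbar_series" where
  "herm = (\<Sum>k\<in>UNIV. mvar (Inl k) * mvar (Inr k))"

definition tr :: "'n::finite zzbar_series \<Rightarrow> 'n zzbar_series" where
  "tr f = (\<Sum>k\<in>UNIV. mderiv (Inl k) (mderiv (Inr k) f))"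

text \<open>A series in \<open>z\<close> regarded as a series in \<open>(z, w)\<close>.\<close>

definition in_zw :: "'n::finite z_series \<Rightarrow> 'n zw_series" where
  "in_zw f = msubst f (\<lambda>k. mvar (Some k))"


section \<open>Real-formal submanifolds of codimension 2, CR singularities, formal maps\<close>

text \<open>The real-formal submanifold \<open>M = {w = \<rho>(z, conj z)}\<close> is represented by the series \<open>\<rho>\<close>.

  A vector \<open>\<Sum>\<^sub>k a\<^sub>k \<partial>/\<partial>(conj z\<^sub>k) + b \<partial>/\<partial>(conj w)\<close> is tangent to \<open>M\<close> iff it annihilates the two
  defining functions \<open>w - \<rho>\<close> and \<open>conj w - conj \<rho>\<close>, i.e. iff
  \<open>\<Sum>\<^sub>k a\<^sub>k \<partial>\<rho>/\<partial>(conj z\<^sub>k) = 0\<close> and \<open>b = \<Sum>\<^sub>k a\<^sub>k \<partial>(conj \<rho>)/\<partial>(conj z\<^sub>k)\<close>.  Below, \<open>r\<close> and \<open>s\<close> are the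
  values of the two gradients at the point under consideration, and the components of \<open>X\<close> with
  index \<^term>\<open>Some k\<close> and \<^term>\<open>None\<close> are \<open>a\<^sub>k\<close> and \<open>b\<close>.\<close>

definition T01 :: "'a::field ^ 'n \<Rightarrow> 'a ^ 'n \<Rightarrow> ('a ^ ('n::finite option)) set" where
  "T01 r s = {X. (\<Sum>k\<in>UNIV. X $ Some k * r $ k) = 0 \<and> X $ None = (\<Sum>k\<in>UNIV. X $ Some k * s $ k)}"

definition T01_origin :: "'n::finite zzbar_series \<Rightarrow> (complex ^ ('n option)) set" where
  "T01_origin \<rho> = T01 (\<chi> k. mcoeff (mderiv (Inr k) \<rho>) 0) (\<chi> k. mcoeff (mderiv (Inr k) (mconj \<rho>)) 0)"

text \<open>A formal submanifold has no points other than the origin; its generic point is the one with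
  values in the field of fractions of the ring of series in \<open>(z, conj z)\<close>.  The dimension over that
  field is the value of the dimension of the (0,1)-space at the nearby generic points, and by
  semicontinuity the dimension jumps at the origin iff its value there differs from it.\<close>

definition T01_generic :: "'n::finite zzbar_series \<Rightarrow> ('n zzbar_series fract ^ ('n option)) set" where
  "T01_generic \<rho> = T01 (\<chi> k. Fract (mderiv (Inr k) \<rho>) 1) (\<chi> k. Fract (mderiv (Inr k) (mconj \<rho>)) 1)"

definition CR_singular_at_origin :: "'n::finite zzbar_series \<Rightarrow> bool" where
  "CR_singular_at_origin \<rho> \<longleftrightarrow>
     mcoeff \<rho> 0 = 0 \<and> vec.dim (T01_origin \<rho>) \<noteq> vec.dim (T01_generic \<rho>)"

lemma T01_eq_image:
  "T01 r s = (\<lambda>v. \<chi> i. case i of Some k \<Rightarrow> v $ k | None \<Rightarrow> (\<Sum>k\<in>UNIV. v $ k * s $ k)) `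
     {v. (\<Sum>k\<in>UNIV. v $ k * r $ k) = 0}"  (is "_ = ?L ` ?K")
proof
  show "T01 r s \<subseteq> ?L ` ?K"
  proof
    fix X assume "X \<in> T01 r s"
    then show "X \<in> ?L ` ?K"
      by (intro image_eqI[of _ _ "\<chi> k. X $ Some k"])
         (auto simp: T01_def vec_eq_iff split: option.split)
  qed
qed (auto simp: T01_def)

lemma dim_T01:
  fixes r s :: "'a::field ^ 'n::finite"
  shows "vec.dim (T01 r s) = vec.dim {v :: 'a ^ 'n. (\<Sum>k\<in>UNIV. v $ k * r $ k) = 0}"
  unfolding T01_eq_image
proof (rule vec.dim_image_eq)
  let ?L = "\<lambda>v :: 'a ^ 'n. (\<chi> i. case i of Some k \<Rightarrow> v $ k | None \<Rightarrow> (\<Sum>k\<in>UNIV. v $ k * s $ k)) :: 'a ^ ('n option)"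
  show "Vector_Spaces.linear (*s) (*s) ?L"
    by unfold_locales
       (auto simp: vec_eq_iff algebra_simps sum.distrib sum_distrib_left split: option.split)
  have "v = w" if "?L v = ?L w" for v w
  proof -
    have "v $ k = w $ k" for k
      using arg_cong[OF that, of "\<lambda>x. x $ Some k"] by simp
    then show ?thesis by (simp add: vec_eq_iff)
  qed
  then show "inj_on ?L (vec.span {v. (\<Sum>k\<in>UNIV. v $ k * r $ k) = 0})"
    by (intro inj_onI) blast
qed

lemma dim_orthogonal:
  fixes r :: "'a::field ^ 'n::finite"
  shows "vec.dim {v :: 'a ^ 'n. (\<Sum>k\<in>UNIV. v $ k * r $ k) = 0} =
    (if r = 0 then CARD('n) else CARD('n) - 1)"
proof (cases "r = 0")
  case True
  then show ?thesis by (simp add: card_cart_basis)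
next
  case False
  let ?p = "\<lambda>v :: 'a ^ 'n. \<Sum>k\<in>UNIV. v $ k * r $ k"
  let ?K = "{v. ?p v = 0}"
  from False obtain j where j: "r $ j \<noteq> 0" by (auto simp: vec_eq_iff)
  let ?e = "axis j 1 :: 'a ^ 'n"
  have p_e: "?p ?e = r $ j"
    by (simp add: axis_def if_distrib[of "\<lambda>x. x * _"] cong: if_cong)
  have "vec.subspace ?K"
    by (rule vec.subspaceI)
       (auto simp: algebra_simps sum.distrib simp flip: sum_distrib_left)
  then have "?e \<notin> vec.span ?K"
    using j p_e by (simp add: vec.span_eq_iff[THEN iffD2])
  moreover have "v \<in> vec.span (insert ?e ?K)" for v
  proof -
    let ?c = "?p v / r $ j"
    have "?p (v - ?c *s ?e) = ?p v - ?c * ?p ?e"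
      unfolding vector_minus_component vector_smult_component left_diff_distrib sum_subtractf
      by (simp only: sum_distrib_left mult.assoc)
    also have "\<dots> = 0" using j by (simp add: p_e)
    finally have "v - ?c *s ?e \<in> vec.span (insert ?e ?K)"
      by (intro vec.span_base) simp
    moreover have "?c *s ?e \<in> vec.span (insert ?e ?K)"
      by (intro vec.span_scale vec.span_base) simp
    ultimately have "(v - ?c *s ?e) + ?c *s ?e \<in> vec.span (insert ?e ?K)"
      by (rule vec.span_add)
    then show ?thesis by simp
  qed
  then have "vec.span (insert ?e ?K) = UNIV" by blast
  then have "vec.dim (insert ?e ?K) = CARD('n)"
    using vec.dim_span[of "insert ?e ?K"] by (simp add: card_cart_basis)
  ultimately show ?thesis
    using False by (simp add: vec.dim_insert)
qed

lemma CR_singular_at_origin_iff: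
  fixes \<rho> :: "'n::finite zzbar_series"
  shows "CR_singular_at_origin \<rho> \<longleftrightarrow>
     mcoeff \<rho> 0 = 0 \<and> (\<forall>k. mcoeff (mderiv (Inr k) \<rho>) 0 = 0) \<and> (\<exists>k. mderiv (Inr k) \<rho> \<noteq> 0)"
proof -
  define r where "r = (\<chi> k. mcoeff (mderiv (Inr k) \<rho>) 0)"
  define R where "R = (\<chi> k. Fract (mderiv (Inr k) \<rho>) 1)"
  have r: "r = 0 \<longleftrightarrow> (\<forall>k. mcoeff (mderiv (Inr k) \<rho>) 0 = 0)"
    by (simp add: r_def vec_eq_iff)
  have R: "R = 0 \<longleftrightarrow> (\<forall>k. mderiv (Inr k) \<rho> = 0)"
    by (simp add: R_def vec_eq_iff Zero_fract_def eq_fract)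
  define K where "K = {v :: complex ^ 'n. (\<Sum>k\<in>UNIV. v $ k * r $ k) = 0}"
  define L where "L = {v :: 'n zzbar_series fract ^ 'n. (\<Sum>k\<in>UNIV. v $ k * R $ k) = 0}"
  have "CR_singular_at_origin \<rho> \<longleftrightarrow> mcoeff \<rho> 0 = 0 \<and> vec.dim K \<noteq> vec.dim L"
    by (simp add: CR_singular_at_origin_def T01_origin_def T01_generic_def dim_T01
                  K_def L_def r_def R_def)
  moreover have "vec.dim K = (if r = 0 then CARD('n) else CARD('n) - 1)"
    unfolding K_def by (rule dim_orthogonal)
  moreover have "vec.dim L = (if R = 0 then CARD('n) else CARD('n) - 1)"
    unfolding L_def by (rule dim_orthogonal)
  moreover have "R \<noteq> 0" if "r \<noteq> 0"
    using that unfolding r R by (metis zero_mfps.rep_eq)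
  moreover have "CARD('n) - 1 \<noteq> CARD('n)" using zero_less_card_finite[where 'a = 'n] by linarith
  ultimately show ?thesis unfolding r R by (auto split: if_splits)
qed

text \<open>The hypothesis that the origin is a CR singularity is consistent with (indeed implied by) the
  form of the defining equation.\<close>

lemma CR_singular_at_origin_herm:
  fixes \<phi> :: "nat \<Rightarrow> nat \<Rightarrow> 'n::finite zzbar_series"
  assumes bihom: "\<And>m n. bihomogeneous m n (\<phi> m n)"
  shows "CR_singular_at_origin (herm + msum {(m, n). m + n \<ge> 3} (\<lambda>(m, n). \<phi> m n))"
proof -
  let ?s = "msum {(m, n). m + n \<ge> 3} (\<lambda>(m, n). \<phi> m n)"
  have s: "mcoeff ?s \<alpha> = 0"
    if "(\<Sum>k\<in>UNIV. \<alpha> $ Inl k) + (\<Sum>k\<in>UNIV. \<alpha> $ Inr k) < 3" for \<alpha>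
  proof -
    have "mcoeff (\<phi> m n) \<alpha> = 0" if "m + n \<ge> 3" for m n
      using bihom[of m n] that \<open>_ < 3\<close> unfolding bihomogeneous_def by fastforce
    then show ?thesis by (auto simp: msum.rep_eq intro!: sum.neutral)
  qed
  have mvar_mvar: "mcoeff (mvar u * mvar v :: 'n zzbar_series) \<alpha> = (if \<alpha> = axis u 1 + axis v 1 then 1 else 0)"
    for u v \<alpha>
  proof -
    have "mcoeff (mvar u * mvar v :: 'n zzbar_series) \<alpha> =
      (\<Sum>(\<beta>, \<gamma>) | \<beta> + \<gamma> = \<alpha>. if (\<beta>, \<gamma>) = (axis u 1, axis v 1) then 1 else 0)"
      unfolding times_mfps.rep_eq by (intro sum.cong) (auto simp: mvar.rep_eq)
    also have "\<dots> = (\<Sum>p | fst p + snd p = \<alpha>. if p = (axis u 1, axis v 1) then 1 else 0)"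
      by (intro sum.cong) (auto split: if_splits)
    also have "\<dots> = (if \<alpha> = axis u 1 + axis v 1 then 1 else 0)"
      using finite_multi_index_split[of \<alpha>, unfolded case_prod_unfold] by (subst sum.delta) auto
    finally show ?thesis .
  qed
  have sum_coeff: "mcoeff (\<Sum>k\<in>A. f k) \<alpha> = (\<Sum>k\<in>A. mcoeff (f k) \<alpha>)"
    if "finite A" for A :: "'n set" and f :: "'n \<Rightarrow> 'n zzbar_series" and \<alpha>
    using that by induction (simp_all add: zero_mfps.rep_eq plus_mfps.rep_eq)
  have herm: "mcoeff (herm :: 'n zzbar_series) \<alpha> =
      (\<Sum>k\<in>UNIV. if \<alpha> = axis (Inl k) 1 + axis (Inr k) 1 then 1 else 0)" for \<alpha>
    by (simp add: herm_def sum_coeff mvar_mvar)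
  have axis_nth: "(axis u 1 :: nat ^ ('n + 'n)) $ v = (if v = u then 1 else 0)" for u v
    by (simp add: axis_def)
  have herm_0: "mcoeff (herm :: 'n zzbar_series) \<alpha> = 0" if "\<And>k. \<alpha> $ Inl k = 0" for \<alpha>
  proof -
    have "\<alpha> \<noteq> axis (Inl k) 1 + axis (Inr k) 1" for k
      using that[of k] by (metis add_is_0 axis_nth vector_add_component zero_neq_one)
    then show ?thesis unfolding herm by simp
  qed
  have herm_2: "mcoeff (herm :: 'n zzbar_series) (axis (Inl k) 1 + axis (Inr k) 1) = 1" for k
  proof -
    have *: "(axis (Inl k) 1 + axis (Inr k) 1 = (axis (Inl l) 1 + axis (Inr l) 1 :: nat ^ ('n + 'n))) \<longleftrightarrow> l = k"
      for l
    proof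
      assume "axis (Inl k) 1 + axis (Inr k) 1 = (axis (Inl l) 1 + axis (Inr l) 1 :: nat ^ ('n + 'n))"
      from arg_cong[OF this, of "\<lambda>x. x $ Inl k"] show "l = k"
        by (simp add: axis_def split: if_splits)
    qed simp
    show ?thesis unfolding herm * by simp
  qed
  fix k0 :: 'n
  have "mcoeff (mderiv (Inr k0) (herm + ?s)) (axis (Inl k0) 1) \<noteq> 0"
    by (simp add: mderiv.rep_eq plus_mfps.rep_eq herm_2 s axis_nth sum.distrib del: One_nat_def)
  then have "mderiv (Inr k0) (herm + ?s) \<noteq> 0" by (auto simp: zero_mfps.rep_eq)
  moreover have "mcoeff (mderiv (Inr k) (herm + ?s)) 0 = 0" for k
    by (simp add: mderiv.rep_eq plus_mfps.rep_eq herm_0 s axis_nth del: One_nat_def)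
  moreover have "mcoeff (herm + ?s) 0 = 0"
    by (simp add: plus_mfps.rep_eq herm_0 s)
  ultimately show ?thesis unfolding CR_singular_at_origin_iff by blast
qed

text \<open>The formal map \<open>(F, G)\<close> transforms \<open>{w = \<rho>}\<close> to \<open>{w' = \<rho>'}\<close>.\<close>

definition restrict_to :: "'n::finite zw_series \<Rightarrow> 'n zzbar_series \<Rightarrow> 'n zzbar_series" where
  "restrict_to f \<rho> = msubst f (\<lambda>v. case v of Some k \<Rightarrow> mvar (Inl k) | None \<Rightarrow> \<rho>)"

definition transforms ::
  "('n::finite \<Rightarrow> 'n zw_series) \<Rightarrow> 'n zw_series \<Rightarrow> 'n zzbar_series \<Rightarrow> 'n zzbar_series \<Rightarrow> bool" where
  "transforms F G \<rho> \<rho>' \<longleftrightarrow>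
     (\<forall>k. mcoeff (F k) 0 = 0) \<and> mcoeff G 0 = 0 \<and>
     restrict_to G \<rho> =
       msubst \<rho>' (\<lambda>v. case v of Inl k \<Rightarrow> restrict_to (F k) \<rho> | Inr k \<Rightarrow> mconj (restrict_to (F k) \<rho>))"

text \<open>\<open>(F, G) = (z + \<Sum> F\<^sub>m\<^sub>n(z) w\<^sup>n, w + \<Sum> G\<^sub>m\<^sub>n(z) w\<^sup>n)\<close>, the sums being over \<open>m + n \<ge> 2\<close>, with homogeneous
  \<open>F\<^sub>m\<^sub>n\<close> and \<open>G\<^sub>m\<^sub>n\<close> of degree \<open>m\<close> such that \<open>F\<^sub>0\<^sub>,\<^sub>n\<^sub>+\<^sub>1 = 0\<close> and \<open>F\<^sub>1\<^sub>,\<^sub>n = 0\<close> for \<open>n \<ge> 1\<close>.\<close>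

definition normalized_map :: "('n::finite \<Rightarrow> 'n zw_series) \<Rightarrow> 'n zw_series \<Rightarrow> bool" where
  "normalized_map F G \<longleftrightarrow>
     (\<exists>(Fc :: nat \<Rightarrow> nat \<Rightarrow> 'n \<Rightarrow> 'n z_series) (Gc :: nat \<Rightarrow> nat \<Rightarrow> 'n z_series).
        (\<forall>m n k. homogeneous m (Fc m n k)) \<and> (\<forall>m n. homogeneous m (Gc m n)) \<and>
        (\<forall>k. F k = mvar (Some k) +
               msum {(m, n). m + n \<ge> 2} (\<lambda>(m, n). in_zw (Fc m n k) * mvar None ^ n)) \<and>
        G = mvar None + msum {(m, n). m + n \<ge> 2} (\<lambda>(m, n). in_zw (Gc m n) * mvar None ^ n) \<and>
        (\<forall>n\<ge>1. \<forall>k. Fc 0 (n + 1) k = 0 \<and> Fc 1 n k = 0))"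

definition partial_normal_form :: "'n::finite zzbar_series \<Rightarrow> bool" where
  "partial_normal_form \<rho>' \<longleftrightarrow>
     (\<exists>\<phi>' :: nat \<Rightarrow> nat \<Rightarrow> 'n zzbar_series.
        (\<forall>m n. bihomogeneous m n (\<phi>' m n)) \<and>
        \<rho>' = herm + msum {(m, n). m + n \<ge> 3 \<and> m \<noteq> 0 \<and> n \<noteq> 0} (\<lambda>(m, n). \<phi>' m n)
               + 2 * mRe (msum {3..} (\<lambda>k. \<phi>' k 0)) \<and>
        (\<forall>m n. m \<noteq> 0 \<and> n \<noteq> 0 \<and> m \<le> n - 1 \<longrightarrow> (tr ^^ (m - 1)) (\<phi>' m n) = 0) \<and>
        (\<forall>m n. m \<noteq> 0 \<and> n \<noteq> 0 \<and> m \<ge> n \<longrightarrow> (tr ^^ n) (\<phi>' m n) = 0))"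

end

theory Submission
  imports Defs
begin

text \<open>
  Write \<open>F\<^sub>k = z\<^sub>k + f\<^sub>k\<close>, \<open>G = w + g\<close> and \<open>\<rho>' = \<langle>z, z\<rangle> + p\<close>.  Modulo terms that are of higher order,
  the transformation equation is linear in \<open>(f, g, p)\<close>, and it has the shape
    \<open>g(z, \<langle>z, z\<rangle>) - p - 2 Re \<langle>f(z, \<langle>z, z\<rangle>), z\<rangle> = R(f, g, p)\<close>.
  Here \<open>w\<close> has weight 2, the orders of \<open>f\<close> are counted one higher because of the pairing with \<open>z\<close>, and \<open>R\<close> is a contraction for the order of vanishing: if two triples agree up
  to order \<open>T\<close>, then their remainders agree up to order \<open>T + 1\<close> (lemma \<open>remainder_contraction\<close>).

  The linear operator on the left preserves degrees.  It is injective on the normalized triples, with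
  an inverse that respects orders, and it attains every series of order at least 3
  (lemmas \<open>linear_part_injective\<close> and \<open>linear_part_surjective\<close>).  This is seen one bidegree
  \<open>(m, n)\<close> at a time.  For \<open>1 \<le> m < n\<close> the component consists of \<open>p\<^sub>m\<^sub>n\<close> and of
  \<open>\<langle>z, z\<rangle>\<^sup>m\<^sup>-\<^sup>1\<close> times an arbitrary polynomial of bidegree \<open>(1, n - m + 1)\<close>, which is the conjugate of
  \<open>\<langle>F\<^sub>a\<^sub>b(z), z\<rangle>\<close> with \<open>a = n - m + 1\<close> and \<open>b = m - 1\<close>; these are exactly the \<open>F\<^sub>a\<^sub>b\<close> left free by the normalization of
  the map.  For \<open>1 \<le> n \<le> m\<close>, once these \<open>F\<^sub>a\<^sub>b\<close> are fixed, it consists of \<open>p\<^sub>m\<^sub>n\<close> and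
  \<open>\<langle>z, z\<rangle>\<^sup>n G\<^sub>m\<^sub>-\<^sub>n\<^sub>,\<^sub>n(z)\<close>.  In both cases the trace condition on \<open>p\<^sub>m\<^sub>n\<close> is complementary to the multiples
  of the power of \<open>\<langle>z, z\<rangle>\<close>; this is the Fischer decomposition
  (lemma \<open>Fischer_decomposition\<close>).  In bidegree \<open>(0, m)\<close> only \<open>p\<close> occurs; as the pure terms of \<open>p\<close> form a real
  series, this fixes \<open>p\<^sub>m\<^sub>0\<close> as well, and bidegree \<open>(m, 0)\<close> then determines \<open>G\<^sub>m\<^sub>0\<close>.

  Composing the inverse of the linear operator with \<open>R\<close> gives a contraction of the series of order at
  least 3.  Its fixed point yields a normalizing map, and the same two estimates,
  applied to two solutions, show by induction on the order that they coincide.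
\<close>

section \<open>Weighted order of a formal power series\<close>

(* Weights and bidegrees contain many literal ones; rewriting them to Suc 0 would hide the lemmas
   about them from the simplifier. *)
declare One_nat_def [simp del]

definition wdeg :: "('v::finite \<Rightarrow> nat) \<Rightarrow> nat ^ 'v \<Rightarrow> nat" where
  "wdeg \<omega> \<alpha> = (\<Sum>v\<in>UNIV. \<omega> v * \<alpha> $ v)"

abbreviation mdeg :: "nat ^ 'v::finite \<Rightarrow> nat" where
  "mdeg \<equiv> wdeg (\<lambda>_. 1)"

text \<open>The space \<open>I\<^sub>T\<close> of the series without terms of weighted degree below \<open>T\<close>; congruence modulo
  these spaces plays the role of a metric.\<close>
definition order_ge :: "('v::finite \<Rightarrow> nat) \<Rightarrow> nat \<Rightarrow> ('v, 'a::comm_ring_1) mfps \<Rightarrow> bool" where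
  "order_ge \<omega> T f \<longleftrightarrow> (\<forall>\<alpha>. wdeg \<omega> \<alpha> < T \<longrightarrow> mcoeff f \<alpha> = 0)"

abbreviation ord_ge :: "nat \<Rightarrow> ('v::finite, 'a::comm_ring_1) mfps \<Rightarrow> bool" where
  "ord_ge \<equiv> order_ge (\<lambda>_. 1)"

lemmas mcoeff_simps = plus_mfps.rep_eq minus_mfps.rep_eq uminus_mfps.rep_eq zero_mfps.rep_eq

lemma mcoeff_sum: "mcoeff (sum f A) \<alpha> = (\<Sum>x\<in>A. mcoeff (f x) \<alpha>)"
  by (induction A rule: infinite_finite_induct) (simp_all add: mcoeff_simps)

lemma wdeg_0 [simp]: "wdeg \<omega> 0 = 0"
  by (simp add: wdeg_def)

lemma wdeg_add [simp]: "wdeg \<omega> (\<alpha> + \<beta>) = wdeg \<omega> \<alpha> + wdeg \<omega> \<beta>"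
  by (simp add: wdeg_def distrib_left sum.distrib)

lemma wdeg_axis [simp]: "wdeg \<omega> (axis v n) = \<omega> v * n"
  by (simp add: wdeg_def axis_def if_distrib cong: if_cong)

lemma finite_mdeg_le: "finite {\<alpha> :: nat ^ 'v::finite. mdeg \<alpha> \<le> n}"
proof (rule finite_subset)
  show "{\<alpha> :: nat ^ 'v. mdeg \<alpha> \<le> n} \<subseteq> {\<alpha>. \<alpha> \<le> (\<chi> v. n)}"
  proof
    fix \<alpha> :: "nat ^ 'v" assume "\<alpha> \<in> {\<alpha>. mdeg \<alpha> \<le> n}"
    then have "\<alpha> $ v \<le> n" for v
      using member_le_sum[of v UNIV "\<lambda>v. \<alpha> $ v"] by (simp add: wdeg_def)
    then show "\<alpha> \<in> {\<alpha>. \<alpha> \<le> (\<chi> v. n)}" by (simp add: less_eq_vec_def)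
  qed
qed (rule finite_multi_index_le)

lemma order_ge_0 [simp]: "order_ge \<omega> 0 f"
  by (simp add: order_ge_def)

lemma order_ge_zero [simp]: "order_ge \<omega> T 0"
  by (simp add: order_ge_def mcoeff_simps)

lemma order_ge_add: "order_ge \<omega> T f \<Longrightarrow> order_ge \<omega> T g \<Longrightarrow> order_ge \<omega> T (f + g)"
  and order_ge_diff: "order_ge \<omega> T f \<Longrightarrow> order_ge \<omega> T g \<Longrightarrow> order_ge \<omega> T (f - g)"
  and order_ge_uminus: "order_ge \<omega> T f \<Longrightarrow> order_ge \<omega> T (- f)"
  by (simp_all add: order_ge_def mcoeff_simps)

lemma order_ge_sum: "(\<And>x. x \<in> A \<Longrightarrow> order_ge \<omega> T (f x)) \<Longrightarrow> order_ge \<omega> T (sum f A)"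
  by (simp add: order_ge_def mcoeff_sum)

lemma order_ge_mono: "order_ge \<omega> T f \<Longrightarrow> T' \<le> T \<Longrightarrow> order_ge \<omega> T' f"
  by (auto simp: order_ge_def)

lemma order_ge_mult:
  assumes "order_ge \<omega> a f" "order_ge \<omega> b g"
  shows "order_ge \<omega> (a + b) (f * g)"
  unfolding order_ge_def
proof (intro allI impI)
  fix \<alpha> assume *: "wdeg \<omega> \<alpha> < a + b"
  show "mcoeff (f * g) \<alpha> = 0"
    unfolding times_mfps.rep_eq
  proof (intro sum.neutral ballI, clarify)
    fix \<beta> \<gamma> assume "\<alpha> = \<beta> + \<gamma>"
    then have "wdeg \<omega> \<beta> < a \<or> wdeg \<omega> \<gamma> < b" using * by simp linarith
    then show "mcoeff f \<beta> * mcoeff g \<gamma> = 0" using assms by (auto simp: order_ge_def)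
  qed
qed

lemma ord_ge_all_imp_eq: "(\<And>T. order_ge \<omega> T (f - g)) \<Longrightarrow> f = g"
  by (rule mfps_eqI) (metis order_ge_def lessI eq_iff_diff_eq_0 minus_mfps.rep_eq)

text \<open>Two series of order \<open>a\<close> that agree up to order \<open>a + d\<close>.  Stating the gain \<open>d\<close> relative to \<open>a\<close> makes the
  relation multiplicative with \<open>d\<close> unchanged, so that it passes to monomials and to substitutions.\<close>

definition close :: "nat \<Rightarrow> nat \<Rightarrow> ('v::finite, 'a::comm_ring_1) mfps \<Rightarrow> ('v, 'a) mfps \<Rightarrow> bool" where
  "close d a x y \<longleftrightarrow> ord_ge a x \<and> ord_ge a y \<and> ord_ge (a + d) (x - y)"

lemma close_mult:
  assumes "close d a x x'" "close d b y y'"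
  shows "close d (a + b) (x * y) (x' * y')"
proof -
  have "x * y - x' * y' = (x - x') * y + x' * (y - y')" by (simp add: algebra_simps)
  moreover have "ord_ge (a + d + b) ((x - x') * y)" "ord_ge (a + (b + d)) (x' * (y - y'))"
    using assms by (auto simp: close_def intro!: order_ge_mult)
  ultimately show ?thesis
    using assms by (auto simp: close_def ac_simps intro!: order_ge_mult order_ge_add)
qed

lemma close_power: "close d a x x' \<Longrightarrow> close d (n * a) (x ^ n) (x' ^ n)"
  by (induction n) (auto simp: close_mult, simp add: close_def)

lemma close_prod:
  "finite A \<Longrightarrow> (\<And>v. v \<in> A \<Longrightarrow> close d (e v) (x v) (x' v)) \<Longrightarrow> close d (sum e A) (prod x A) (prod x' A)"
  by (induction A rule: finite_induct) (auto simp: close_mult, simp add: close_def)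

lemma close_monomial:
  assumes "\<And>v. close d (\<omega> v) (x v) (x' v)"
  shows "close d (wdeg \<omega> \<beta>) (\<Prod>v\<in>UNIV. x v ^ (\<beta> $ v)) (\<Prod>v\<in>UNIV. x' v ^ (\<beta> $ v))"
  unfolding wdeg_def using close_power[OF assms]
  by (intro close_prod) (simp_all add: mult.commute[of "\<omega> _"])

lemma ord_ge_monomial:
  assumes "\<And>v. ord_ge (\<omega> v) (x v)"
  shows "ord_ge (wdeg \<omega> \<beta>) (\<Prod>v\<in>UNIV. x v ^ (\<beta> $ v))"
  using close_monomial[of 0 \<omega> x x \<beta>] assms by (simp add: close_def)

text \<open>Banach's principle: the iterates from \<open>0\<close> stabilize in each degree, and the limit is read off
  coefficientwise.\<close>
lemma contraction_fixed_point:
  fixes \<Phi> :: "('v::finite, 'a::comm_ring_1) mfps \<Rightarrow> ('v, 'a) mfps"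
  assumes ord: "\<And>H. ord_ge d H \<Longrightarrow> ord_ge d (\<Phi> H)"
    and contr: "\<And>T H H'. ord_ge d H \<Longrightarrow> ord_ge d H' \<Longrightarrow> ord_ge T (H - H') \<Longrightarrow> ord_ge (T + 1) (\<Phi> H - \<Phi> H')"
  shows "\<exists>H. ord_ge d H \<and> \<Phi> H = H"
proof -
  define h where "h n = (\<Phi> ^^ n) 0" for n
  have h_Suc: "h (Suc n) = \<Phi> (h n)" for n by (simp add: h_def)
  have h_ord: "ord_ge d (h n)" for n
    by (induction n) (simp_all add: h_Suc ord, simp add: h_def)
  have step: "ord_ge n (h (Suc n) - h n)" for n
  proof (induction n)
    case (Suc n)
    then show ?case using contr[OF h_ord h_ord, of n "Suc n" n] by (simp add: h_Suc Suc_eq_plus1[symmetric] del: Suc_eq_plus1)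
  qed simp
  have later: "ord_ge n (h (n + i) - h n)" for n i
  proof (induction i)
    case (Suc i)
    have "ord_ge n (h (Suc (n + i)) - h (n + i))" by (rule order_ge_mono[OF step]) simp
    from order_ge_add[OF this Suc] show ?case by simp
  qed simp
  define H where "H = Abs_mfps (\<lambda>\<alpha>. mcoeff (h (Suc (mdeg \<alpha>))) \<alpha>)"
  have mcoeff_H: "mcoeff H \<alpha> = mcoeff (h (Suc (mdeg \<alpha>))) \<alpha>" for \<alpha>
    by (simp add: H_def Abs_mfps_inverse)
  have H: "ord_ge n (H - h n)" for n
    unfolding order_ge_def
  proof (intro allI impI)
    fix \<alpha> :: "nat ^ 'v" assume "mdeg \<alpha> < n"
    then have "ord_ge (Suc (mdeg \<alpha>)) (h n - h (Suc (mdeg \<alpha>)))"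
      using later[of "Suc (mdeg \<alpha>)" "n - Suc (mdeg \<alpha>)"] by simp
    then show "mcoeff (H - h n) \<alpha> = 0"
      by (simp add: mcoeff_H mcoeff_simps order_ge_def)
  qed
  have H_ord: "ord_ge d H"
    using h_ord by (simp add: order_ge_def mcoeff_H)
  have "ord_ge n (\<Phi> H - H)" for n
  proof -
    have "ord_ge n (\<Phi> H - h (Suc n))"
      using contr[OF H_ord h_ord H, of n] unfolding h_Suc by (rule order_ge_mono) simp
    moreover have "ord_ge n (H - h (Suc n))" by (rule order_ge_mono[OF H]) simp
    ultimately have "ord_ge n ((\<Phi> H - h (Suc n)) - (H - h (Suc n)))" by (rule order_ge_diff)
    then show ?thesis by simp
  qed
  then have "\<Phi> H = H" by (rule ord_ge_all_imp_eq)
  with H_ord show ?thesis by blast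
qed
section \<open>Substitution\<close>

lemma mcoeff_mult:
  "mcoeff (f * g) \<alpha> = (\<Sum>p | fst p + snd p = \<alpha>. mcoeff f (fst p) * mcoeff g (snd p))"
  by (simp add: times_mfps.rep_eq case_prod_unfold)

lemma finite_splits: "finite {p. fst p + snd p = (\<alpha> :: nat ^ 'v::finite)}"
  using finite_multi_index_split[of \<alpha>] by (simp add: case_prod_unfold)

lemma mcoeff_mult_single:
  assumes "\<And>\<beta>. \<beta> \<noteq> \<gamma> \<Longrightarrow> mcoeff f \<beta> = 0"
  shows "mcoeff (f * g) (\<gamma> + \<alpha>) = mcoeff f \<gamma> * mcoeff g \<alpha>"
proof -
  have "mcoeff (f * g) (\<gamma> + \<alpha>) = (\<Sum>p\<in>{(\<gamma>, \<alpha>)}. mcoeff f (fst p) * mcoeff g (snd p))"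
    unfolding mcoeff_mult
  proof (rule sum.mono_neutral_right[OF finite_splits])
    show "\<forall>p\<in>{p. fst p + snd p = \<gamma> + \<alpha>} - {(\<gamma>, \<alpha>)}. mcoeff f (fst p) * mcoeff g (snd p) = 0"
    proof
      fix p assume p: "p \<in> {p. fst p + snd p = \<gamma> + \<alpha>} - {(\<gamma>, \<alpha>)}"
      then have "fst p \<noteq> \<gamma>" by (cases p) auto
      then show "mcoeff f (fst p) * mcoeff g (snd p) = 0" using assms by simp
    qed
  qed auto
  then show ?thesis by simp
qed

lemma mcoeff_mconst_mult: "mcoeff (mconst c * f) \<alpha> = c * mcoeff f \<alpha>"
  using mcoeff_mult_single[of 0 "mconst c" f \<alpha>] by (simp add: mconst.rep_eq)

text \<open>Since \<open>g\<close> has no constant terms, a monomial \<open>\<Prod>\<^sub>v g\<^sub>v\<^sup>\<beta>\<^sup>v\<close> has order at least the degree of \<open>\<beta>\<close>; hence only finitely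
  many \<open>\<beta>\<close> contribute to a given coefficient, and the bound \<open>n\<close> may be chosen uniformly.\<close>
lemma mcoeff_msubst:
  assumes g: "\<And>v. ord_ge 1 (g v)" and n: "mdeg \<alpha> \<le> n"
  shows "mcoeff (msubst f g) \<alpha> =
    (\<Sum>\<beta> | mdeg \<beta> \<le> n. mcoeff f \<beta> * mcoeff (\<Prod>v\<in>UNIV. g v ^ (\<beta> $ v)) \<alpha>)"
proof -
  let ?t = "\<lambda>\<beta>. mcoeff f \<beta> * mcoeff (\<Prod>v\<in>UNIV. g v ^ (\<beta> $ v)) \<alpha>"
  have "?t \<beta> = 0" if "\<not> mdeg \<beta> \<le> n" for \<beta>
    using ord_ge_monomial[of "\<lambda>_. 1" g \<beta>] g that n by (simp add: order_ge_def)
  then have "{\<beta>. ?t \<beta> \<noteq> 0} \<subseteq> {\<beta>. mdeg \<beta> \<le> n}" by blast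
  then have "(\<Sum>\<beta> | ?t \<beta> \<noteq> 0. ?t \<beta>) = (\<Sum>\<beta> | mdeg \<beta> \<le> n. ?t \<beta>)"
    by (intro sum.mono_neutral_left finite_mdeg_le) auto
  then show ?thesis by (simp add: msubst_def msum.rep_eq mcoeff_mconst_mult)
qed

lemma msubst_add:
  assumes "\<And>v. ord_ge 1 (g v)"
  shows "msubst (f + f') g = msubst f g + msubst f' g"
  by (rule mfps_eqI)
     (simp add: mcoeff_msubst[OF assms order.refl] mcoeff_simps distrib_right sum.distrib)

lemma msubst_diff:
  assumes "\<And>v. ord_ge 1 (g v)"
  shows "msubst (f - f') g = msubst f g - msubst f' g"
  using msubst_add[OF assms, of "f - f'" f'] by simp

lemma msubst_sum:
  assumes "\<And>v. ord_ge 1 (g v)"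
  shows "msubst (\<Sum>i\<in>I. f i) g = (\<Sum>i\<in>I. msubst (f i) g)"
proof (induction I rule: infinite_finite_induct)
  have "msubst 0 g = 0" using msubst_diff[OF assms, of 0 0] by simp
  then show "msubst (\<Sum>i\<in>{}. f i) g = (\<Sum>i\<in>{}. msubst (f i) g)"
    "\<And>I. infinite I \<Longrightarrow> msubst (\<Sum>i\<in>I. f i) g = (\<Sum>i\<in>I. msubst (f i) g)" by simp_all
qed (simp add: msubst_add[OF assms])

text \<open>The estimate behind every later comparison of orders: replacing each \<open>x\<^sub>v\<close>, which has order \<open>\<omega> v\<close>, by a
  series that agrees with it up to \<open>d\<close> further orders changes \<open>f(x)\<close> only \<open>d\<close> orders above the weighted
  order of \<open>f\<close>.  It is used for \<open>w = \<rho>\<close> against \<open>w = \<langle>z, z\<rangle>\<close>, and for two changes of the variables \<open>z\<close>.\<close>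
lemma msubst_close:
  fixes f :: "('v::finite, 'a::comm_ring_1) mfps" and x x' :: "'v \<Rightarrow> ('u::finite, 'a) mfps"
  assumes "\<And>v. \<omega> v \<ge> 1" "\<And>v. close d (\<omega> v) (x v) (x' v)" "order_ge \<omega> T f"
  shows "close d T (msubst f x) (msubst f x')"
proof -
  have x: "ord_ge 1 (x v)" "ord_ge 1 (x' v)" for v
    using assms(1,2)[of v] by (auto simp: close_def intro: order_ge_mono)
  define m where "m y \<beta> = (\<Prod>v\<in>UNIV. y v ^ (\<beta> $ v))"  for y :: "'v \<Rightarrow> ('u, 'a) mfps" and \<beta>
  have m: "close d (wdeg \<omega> \<beta>) (m x \<beta>) (m x' \<beta>)" for \<beta>
    unfolding m_def by (rule close_monomial[OF assms(2)])
  have *: "mcoeff f \<beta> = 0 \<or> ord_ge T (m x \<beta>) \<and> ord_ge T (m x' \<beta>) \<and> ord_ge (T + d) (m x \<beta> - m x' \<beta>)" for \<beta>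
    using m[of \<beta>] assms(3) order_ge_mono[of _ _ _ T] order_ge_mono[of _ "wdeg \<omega> \<beta> + d" _ "T + d"]
    unfolding close_def order_ge_def[of \<omega>] by (meson add_le_mono1 not_le)
  have lt: "mcoeff f \<beta> * mcoeff (m x \<beta>) \<alpha> = 0" "mcoeff f \<beta> * mcoeff (m x' \<beta>) \<alpha> = 0"
    if "mdeg \<alpha> < T" for \<alpha> \<beta>
    using *[of \<beta>] that by (auto simp: order_ge_def)
  have diff: "mcoeff f \<beta> * mcoeff (m x \<beta>) \<alpha> - mcoeff f \<beta> * mcoeff (m x' \<beta>) \<alpha> = 0"
    if "mdeg \<alpha> < T + d" for \<alpha> \<beta>
    using *[of \<beta>] that by (auto simp: order_ge_def mcoeff_simps)
  show ?thesis
    unfolding close_def order_ge_def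
    by (auto simp: mcoeff_msubst[OF x(1) order.refl] mcoeff_msubst[OF x(2) order.refl]
        mcoeff_simps sum_subtractf[symmetric] lt[unfolded m_def] diff[unfolded m_def] intro!: sum.neutral)
qed

section \<open>Monomials\<close>

lift_definition mmonom :: "nat ^ 'v::finite \<Rightarrow> ('v, 'a::comm_ring_1) mfps"
  is "\<lambda>\<gamma> \<alpha>. if \<alpha> = \<gamma> then 1 else 0" .

lemma mcoeff_mmonom_mult: "mcoeff (mmonom \<gamma> * f) (\<gamma> + \<alpha>) = mcoeff f \<alpha>"
  using mcoeff_mult_single[of \<gamma> "mmonom \<gamma>" f \<alpha>] by (simp add: mmonom.rep_eq)

lemma mcoeff_mmonom_mult_eq_0:
  assumes "\<And>\<delta>. \<alpha> \<noteq> \<gamma> + \<delta>"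
  shows "mcoeff (mmonom \<gamma> * f) \<alpha> = 0"
  unfolding mcoeff_mult
proof (intro sum.neutral ballI)
  fix p assume "p \<in> {p. fst p + snd p = \<alpha>}"
  then have "\<alpha> = fst p + snd p" by simp
  then have "fst p \<noteq> \<gamma>" using assms by metis
  then show "mcoeff (mmonom \<gamma>) (fst p) * mcoeff f (snd p) = 0" by (simp add: mmonom.rep_eq)
qed

lemma mmonom_mult: "mmonom \<gamma> * mmonom \<delta> = mmonom (\<gamma> + \<delta>)"
proof (rule mfps_eqI)
  fix \<alpha>
  show "mcoeff (mmonom \<gamma> * mmonom \<delta>) \<alpha> = mcoeff (mmonom (\<gamma> + \<delta>)) \<alpha>"
  proof (cases "\<exists>\<beta>. \<alpha> = \<gamma> + \<beta>")
    case True
    then obtain \<beta> where "\<alpha> = \<gamma> + \<beta>" by blast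
    then show ?thesis by (simp add: mcoeff_mmonom_mult) (simp add: mmonom.rep_eq)
  next
    case False
    then have "mcoeff (mmonom \<gamma> * mmonom \<delta>) \<alpha> = 0" by (intro mcoeff_mmonom_mult_eq_0) blast
    with False show ?thesis by (auto simp: mmonom.rep_eq)
  qed
qed

lemma mmonom_0: "mmonom 0 = 1"
  by transfer simp

lemma mvar_eq_mmonom: "mvar v = mmonom (axis v 1)"
  by transfer simp

lemma mvar_power_eq_mmonom: "mvar v ^ n = mmonom (axis v n)"
proof (induction n)
  case (Suc n)
  have "axis v 1 + axis v n = axis v (Suc n)" by (auto simp: vec_eq_iff axis_def)
  then show ?case by (metis power_Suc Suc mvar_eq_mmonom mmonom_mult)
qed (simp add: mmonom_0 axis_def zero_vec_def[symmetric])

lemma prod_mvar_power_eq_mmonom: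
  "finite A \<Longrightarrow> inj_on s A \<Longrightarrow>
   (\<Prod>k\<in>A. mvar (s k) ^ (e k)) = mmonom (\<Sum>k\<in>A. axis (s k) (e k))"
  by (induction A rule: finite_induct) (simp_all add: mmonom_0 mvar_power_eq_mmonom mmonom_mult)

lemma msubst_mmonom:
  fixes g :: "'v::finite \<Rightarrow> ('u::finite, 'a::comm_ring_1) mfps"
  assumes "\<And>v. ord_ge 1 (g v)"
  shows "msubst (mmonom \<gamma>) g = (\<Prod>v\<in>UNIV. g v ^ (\<gamma> $ v))"
proof (rule mfps_eqI)
  fix \<alpha> :: "nat ^ 'u"
  let ?n = "max (mdeg \<alpha>) (mdeg \<gamma>)"
  have "mcoeff (msubst (mmonom \<gamma>) g) \<alpha> =
      (\<Sum>\<beta> | mdeg \<beta> \<le> ?n. if \<beta> = \<gamma> then mcoeff (\<Prod>v\<in>UNIV. g v ^ (\<beta> $ v)) \<alpha> else 0)"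
    unfolding mcoeff_msubst[OF assms max.cobounded1[of "mdeg \<alpha>" "mdeg \<gamma>"]]
    by (intro sum.cong) (simp_all add: mmonom.rep_eq)
  also have "\<dots> = mcoeff (\<Prod>v\<in>UNIV. g v ^ (\<gamma> $ v)) \<alpha>"
    by (subst sum.delta) (auto intro: finite_mdeg_le)
  finally show "mcoeff (msubst (mmonom \<gamma>) g) \<alpha> = mcoeff (\<Prod>v\<in>UNIV. g v ^ (\<gamma> $ v)) \<alpha>" .
qed

lemma prod_power_axis: "(\<Prod>v\<in>UNIV. g v ^ (axis u n $ v)) = g u ^ n" for g :: "'v::finite \<Rightarrow> 'b::comm_monoid_mult"
proof -
  have "(\<Prod>v\<in>UNIV. g v ^ (axis u n $ v)) = (\<Prod>v\<in>UNIV. if v = u then g v ^ n else 1)"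
    by (intro prod.cong) (simp_all add: axis_def)
  then show ?thesis by simp
qed

lemma msubst_mvar:
  assumes "\<And>v. ord_ge 1 (g v)"
  shows "msubst (mvar v) g = g v"
  unfolding mvar_eq_mmonom msubst_mmonom[OF assms] by (simp add: prod_power_axis)

lemma msubst_mvar_mult_mvar:
  assumes "\<And>v. ord_ge 1 (g v)"
  shows "msubst (mvar u * mvar v) g = g u * g v"
  unfolding mvar_eq_mmonom mmonom_mult msubst_mmonom[OF assms]
  by (simp add: prod_power_axis power_add prod.distrib)

lemma ord_ge_mvar: "ord_ge 1 (mvar v)"
  by (auto simp: order_ge_def mvar_eq_mmonom mmonom.rep_eq)

lemma msubst_mvar_id: "msubst f mvar = f"
proof (rule mfps_eqI)
  fix \<alpha>
  have e: "(\<Sum>v\<in>UNIV. axis v (\<beta> $ v)) = \<beta>" for \<beta> :: "nat ^ 'a"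
    by (simp add: vec_eq_iff axis_def)
  have "(\<Prod>v\<in>UNIV. mvar v ^ (\<beta> $ v)) = (mmonom \<beta> :: ('a, 'b) mfps)" for \<beta>
    using prod_mvar_power_eq_mmonom[of UNIV "\<lambda>v. v" "vec_nth \<beta>"] by (simp add: e)
  then have "mcoeff (msubst f mvar) \<alpha> =
      (\<Sum>\<beta> | mdeg \<beta> \<le> mdeg \<alpha>. if \<beta> = \<alpha> then mcoeff f \<beta> else 0)"
    unfolding mcoeff_msubst[OF ord_ge_mvar order.refl]
    by (intro sum.cong) (auto simp: mmonom.rep_eq)
  also have "\<dots> = mcoeff f \<alpha>" by (subst sum.delta) (auto intro: finite_mdeg_le)
  finally show "mcoeff (msubst f mvar) \<alpha> = mcoeff f \<alpha>" .
qed

section \<open>Derivatives\<close>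

lemma mderiv_add: "mderiv v (f + g) = mderiv v f + mderiv v g"
  and mderiv_diff: "mderiv v (f - g) = mderiv v f - mderiv v g"
  and mderiv_0: "mderiv v 0 = 0"
  by (rule mfps_eqI, simp add: mderiv.rep_eq mcoeff_simps algebra_simps)+

lemma mderiv_sum: "mderiv v (sum f A) = (\<Sum>x\<in>A. mderiv v (f x))"
  by (induction A rule: infinite_finite_induct) (simp_all add: mderiv_add mderiv_0)

lemma mderiv_mconst_mult: "mderiv v (mconst c * f) = mconst c * mderiv v f"
  by (rule mfps_eqI) (simp add: mderiv.rep_eq mcoeff_mconst_mult mult.left_commute)

lemma mcoeff_mvar_mult:
  "mcoeff (mvar v * f) \<alpha> = (if \<alpha> $ v = 0 then 0 else mcoeff f (\<alpha> - axis v 1))"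
proof (cases "\<alpha> $ v = 0")
  case True
  have "\<alpha> \<noteq> axis v 1 + \<delta>" for \<delta>
    using True by (metis add_is_0 axis_nth vector_add_component zero_neq_one)
  then show ?thesis using True by (simp add: mvar_eq_mmonom mcoeff_mmonom_mult_eq_0)
next
  case False
  then have "\<alpha> = axis v 1 + (\<alpha> - axis v 1)" by (auto simp: vec_eq_iff axis_def)
  then show ?thesis using False mcoeff_mmonom_mult[of "axis v 1" f "\<alpha> - axis v 1"]
    by (simp add: mvar_eq_mmonom)
qed

lemma mderiv_mvar_mult:
  "mderiv u (mvar v * f) = (if u = v then f else 0) + mvar v * mderiv u f"
proof (rule mfps_eqI)
  fix \<alpha>
  show "mcoeff (mderiv u (mvar v * f)) \<alpha> = mcoeff ((if u = v then f else 0) + mvar v * mderiv u f) \<alpha>"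
  proof (cases "\<alpha> $ v = 0")
    case True
    then show ?thesis
      by (auto simp: mderiv.rep_eq mcoeff_mvar_mult mcoeff_simps axis_def)
  next
    case False
    then have 1: "\<alpha> + axis u 1 - axis v 1 = \<alpha> - axis v 1 + axis u 1" by (auto simp: vec_eq_iff axis_def)
    have 2: "(\<alpha> + axis u 1) $ v \<noteq> 0" using False by simp
    have 3: "(\<alpha> - axis v 1) $ u = (if u = v then \<alpha> $ u - 1 else \<alpha> $ u)" by (simp add: axis_def)
    have 4: "\<alpha> - axis v 1 + axis v 1 = \<alpha>" using False by (auto simp: vec_eq_iff axis_def)
    show ?thesis
      unfolding mderiv.rep_eq mcoeff_mvar_mult mcoeff_simps 1 if_not_P[OF 2] if_not_P[OF False] 3
      using False 4 by (auto simp: algebra_simps of_nat_diff mcoeff_simps)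
  qed
qed

section \<open>Bihomogeneous polynomials\<close>

definition zdeg :: "nat ^ ('n::finite + 'n) \<Rightarrow> nat" where
  "zdeg \<alpha> = (\<Sum>k\<in>UNIV. \<alpha> $ Inl k)"

definition zbardeg :: "nat ^ ('n::finite + 'n) \<Rightarrow> nat" where
  "zbardeg \<alpha> = (\<Sum>k\<in>UNIV. \<alpha> $ Inr k)"

lemma bihomogeneous_iff:
  "bihomogeneous m n f \<longleftrightarrow> (\<forall>\<alpha>. mcoeff f \<alpha> \<noteq> 0 \<longrightarrow> zdeg \<alpha> = m \<and> zbardeg \<alpha> = n)"
  by (simp add: bihomogeneous_def zdeg_def zbardeg_def)

lemma mcoeff_bihomogeneous_eq_0:
  "bihomogeneous m n f \<Longrightarrow> zdeg \<alpha> \<noteq> m \<or> zbardeg \<alpha> \<noteq> n \<Longrightarrow> mcoeff f \<alpha> = 0"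
  by (auto simp: bihomogeneous_iff)
lemma zdeg_add [simp]: "zdeg (\<alpha> + \<beta>) = zdeg \<alpha> + zdeg \<beta>"
  and zbardeg_add [simp]: "zbardeg (\<alpha> + \<beta>) = zbardeg \<alpha> + zbardeg \<beta>"
  by (simp_all add: zdeg_def zbardeg_def sum.distrib)

lemma zdeg_axis [simp]: "zdeg (axis (Inl k) i) = i" "zdeg (axis (Inr k) i) = 0"
  and zbardeg_axis [simp]: "zbardeg (axis (Inl k) i) = 0" "zbardeg (axis (Inr k) i) = i"
  by (simp_all add: zdeg_def zbardeg_def axis_def)

lemma mdeg_eq: "mdeg \<alpha> = zdeg \<alpha> + zbardeg \<alpha>"
  unfolding wdeg_def zdeg_def zbardeg_def UNIV_Plus_UNIV[symmetric]
  by (subst sum.Plus) auto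

lemma bihomogeneous_0 [simp]: "bihomogeneous m n 0"
  by (simp add: bihomogeneous_iff mcoeff_simps)

lemma bihomogeneous_1 [simp]: "bihomogeneous 0 0 1"
  by (auto simp: bihomogeneous_iff one_mfps.rep_eq zdeg_def zbardeg_def)

lemma bihomogeneous_add: "bihomogeneous m n f \<Longrightarrow> bihomogeneous m n g \<Longrightarrow> bihomogeneous m n (f + g)"
  and bihomogeneous_diff: "bihomogeneous m n f \<Longrightarrow> bihomogeneous m n g \<Longrightarrow> bihomogeneous m n (f - g)"
  and bihomogeneous_uminus: "bihomogeneous m n f \<Longrightarrow> bihomogeneous m n (- f)"
  unfolding bihomogeneous_iff mcoeff_simps by (metis add_0_left, metis diff_zero, simp)

lemma bihomogeneous_sum:
  "(\<And>x. x \<in> A \<Longrightarrow> bihomogeneous m n (f x)) \<Longrightarrow> bihomogeneous m n (sum f A)"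
  by (induction A rule: infinite_finite_induct) (simp_all add: bihomogeneous_add)

lemma bihomogeneous_mconst_mult: "bihomogeneous m n f \<Longrightarrow> bihomogeneous m n (mconst c * f)"
  by (auto simp: bihomogeneous_iff mcoeff_mconst_mult)

lemma bihomogeneous_mult:
  assumes "bihomogeneous m n f" "bihomogeneous m' n' g"
  shows "bihomogeneous (m + m') (n + n') (f * g)"
  unfolding bihomogeneous_iff
proof (intro allI impI)
  fix \<alpha> assume "mcoeff (f * g) \<alpha> \<noteq> 0"
  then obtain p where p: "fst p + snd p = \<alpha>" "mcoeff f (fst p) \<noteq> 0" "mcoeff g (snd p) \<noteq> 0"
    unfolding mcoeff_mult by (auto elim: sum.not_neutral_contains_not_neutral)
  then have "zdeg (fst p) = m \<and> zbardeg (fst p) = n" "zdeg (snd p) = m' \<and> zbardeg (snd p) = n'"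
    using assms unfolding bihomogeneous_iff by blast+
  then show "zdeg \<alpha> = m + m' \<and> zbardeg \<alpha> = n + n'"
    unfolding p(1)[symmetric] by simp
qed

lemma bihomogeneous_mvar [simp]: "bihomogeneous 1 0 (mvar (Inl k))" "bihomogeneous 0 1 (mvar (Inr k))"
  by (simp_all add: bihomogeneous_iff mvar.rep_eq)

lemma bihomogeneous_herm: "bihomogeneous 1 1 (herm :: 'n::finite zzbar_series)"
proof -
  have "bihomogeneous (1 + 0) (0 + 1) (mvar (Inl k) * mvar (Inr k))" for k :: 'n
    by (intro bihomogeneous_mult bihomogeneous_mvar)
  then show ?thesis unfolding herm_def by (intro bihomogeneous_sum) simp
qed

lemma bihomogeneous_herm_mult: "bihomogeneous m n f \<Longrightarrow> bihomogeneous (Suc m) (Suc n) (herm * f)"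
  using bihomogeneous_mult[OF bihomogeneous_herm] by (metis plus_1_eq_Suc)

lemma bihomogeneous_herm_power: "bihomogeneous k k (herm ^ k :: 'n::finite zzbar_series)"
  by (induction k) (simp_all add: bihomogeneous_herm_mult)

lemma bihomogeneous_herm_power_mult:
  "bihomogeneous m n f \<Longrightarrow> bihomogeneous (m + k) (n + k) (herm ^ k * f)"
  using bihomogeneous_mult[OF bihomogeneous_herm_power, of m n f k] by (simp add: add.commute)

lemma bihomogeneous_mderiv:
  shows "bihomogeneous (Suc m) n f \<Longrightarrow> bihomogeneous m n (mderiv (Inl k) f)"
    and "bihomogeneous m (Suc n) f \<Longrightarrow> bihomogeneous m n (mderiv (Inr k) f)"
  by (force simp: bihomogeneous_iff mderiv.rep_eq)+

lemma mderiv_bihomogeneous_0: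
  shows "bihomogeneous 0 n f \<Longrightarrow> mderiv (Inl k) f = 0"
    and "bihomogeneous m 0 f \<Longrightarrow> mderiv (Inr k) f = 0"
  by (rule mfps_eqI, force simp: bihomogeneous_iff mderiv.rep_eq mcoeff_simps)+

lemma bihomogeneous_tr:
  assumes "bihomogeneous (Suc m) (Suc n) f"
  shows "bihomogeneous m n (tr f)"
  unfolding tr_def by (intro bihomogeneous_sum bihomogeneous_mderiv assms)

lemma tr_bihomogeneous_0: "bihomogeneous m n f \<Longrightarrow> m = 0 \<or> n = 0 \<Longrightarrow> tr f = 0"
proof (unfold tr_def, intro sum.neutral ballI)
  fix k assume f: "bihomogeneous m n f" "m = 0 \<or> n = 0"
  show "mderiv (Inl k) (mderiv (Inr k) f) = 0"
  proof (cases n)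
    case 0
    then show ?thesis using f mderiv_bihomogeneous_0(2)[of m f k] by (simp add: mderiv_0)
  next
    case (Suc i)
    then show ?thesis using f by (intro mderiv_bihomogeneous_0(1)[of i] bihomogeneous_mderiv(2)) auto
  qed
qed

lemma bihomogeneous_funpow_tr:
  "bihomogeneous (m + k) (n + k) f \<Longrightarrow> bihomogeneous m n ((tr ^^ k) f)"
  by (induction k arbitrary: f) (simp_all add: funpow_Suc_right bihomogeneous_tr del: funpow.simps)

lemma tr_add: "tr (f + g) = tr f + tr g"
  and tr_diff: "tr (f - g) = tr f - tr g"
  and tr_0: "tr 0 = 0"
  and tr_mconst_mult: "tr (mconst c * f) = mconst c * tr f"
  by (simp_all add: tr_def mderiv_add mderiv_diff mderiv_0 mderiv_mconst_mult sum.distrib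
      sum_subtractf sum_distrib_left)

lemma funpow_tr_add: "(tr ^^ k) (f + g) = (tr ^^ k) f + (tr ^^ k) g"
  and funpow_tr_diff: "(tr ^^ k) (f - g) = (tr ^^ k) f - (tr ^^ k) g"
  and funpow_tr_0: "(tr ^^ k) 0 = 0"
  by (induction k) (simp_all add: tr_add tr_diff tr_0)

text \<open>Euler's identity for homogeneous polynomials, in each group of variables.\<close>

lemma euler:
  assumes "bihomogeneous m n f"
  shows euler_z: "(\<Sum>k\<in>UNIV. mvar (Inl k) * mderiv (Inl k) f) = mconst (of_nat m) * f"
    and euler_zbar: "(\<Sum>k\<in>UNIV. mvar (Inr k) * mderiv (Inr k) f) = mconst (of_nat n) * f"
proof -
  have *: "mcoeff (mvar v * mderiv v f) \<alpha> = of_nat (\<alpha> $ v) * mcoeff f \<alpha>" for v \<alpha>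
  proof (cases "\<alpha> $ v = 0")
    case False
    have 1: "\<alpha> - axis v 1 + axis v 1 = \<alpha>" using False by (auto simp: vec_eq_iff axis_def)
    have 2: "(\<alpha> - axis v 1) $ v + 1 = \<alpha> $ v" using False by (simp add: axis_def)
    show ?thesis unfolding mcoeff_mvar_mult mderiv.rep_eq if_not_P[OF False] 1 2 ..
  qed (simp add: mcoeff_mvar_mult)
  have deg: "mcoeff f \<alpha> = 0 \<or> zdeg \<alpha> = m \<and> zbardeg \<alpha> = n" for \<alpha>
    using assms unfolding bihomogeneous_iff by blast
  show "(\<Sum>k\<in>UNIV. mvar (Inl k) * mderiv (Inl k) f) = mconst (of_nat m) * f"
  proof (rule mfps_eqI)
    fix \<alpha>
    have "mcoeff (\<Sum>k\<in>UNIV. mvar (Inl k) * mderiv (Inl k) f) \<alpha> = of_nat (zdeg \<alpha>) * mcoeff f \<alpha>"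
      by (simp only: mcoeff_sum * sum_distrib_right[symmetric] zdeg_def of_nat_sum)
    then show "mcoeff (\<Sum>k\<in>UNIV. mvar (Inl k) * mderiv (Inl k) f) \<alpha> = mcoeff (mconst (of_nat m) * f) \<alpha>"
      using deg[of \<alpha>] by (auto simp: mcoeff_mconst_mult)
  qed
  show "(\<Sum>k\<in>UNIV. mvar (Inr k) * mderiv (Inr k) f) = mconst (of_nat n) * f"
  proof (rule mfps_eqI)
    fix \<alpha>
    have "mcoeff (\<Sum>k\<in>UNIV. mvar (Inr k) * mderiv (Inr k) f) \<alpha> = of_nat (zbardeg \<alpha>) * mcoeff f \<alpha>"
      by (simp only: mcoeff_sum * sum_distrib_right[symmetric] zbardeg_def of_nat_sum)
    then show "mcoeff (\<Sum>k\<in>UNIV. mvar (Inr k) * mderiv (Inr k) f) \<alpha> = mcoeff (mconst (of_nat n) * f) \<alpha>"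
      using deg[of \<alpha>] by (auto simp: mcoeff_mconst_mult)
  qed
qed

section \<open>Fischer decomposition\<close>

lemma mconst_add: "mconst (a + b) = mconst a + mconst b"
  by (rule mfps_eqI) (simp add: mconst.rep_eq mcoeff_simps)

lemma mconst_mult: "mconst (a * b) = mconst a * mconst b"
  by (rule mfps_eqI) (simp add: mconst.rep_eq mcoeff_mconst_mult)

lemma mconst_1: "mconst 1 = 1"
  by (rule mfps_eqI) (simp add: mconst.rep_eq one_mfps.rep_eq)

lemma mconst_of_nat: "mconst (of_nat n) = of_nat n"
proof (induction n)
  case 0
  show ?case by (rule mfps_eqI) (simp add: mconst.rep_eq mcoeff_simps)
qed (simp add: mconst_add mconst_1)

text \<open>The commutator of \<open>tr\<close> and multiplication by \<open>\<langle>z, z\<rangle>\<close> is the sum of the two Euler operators plus \<open>N\<close>,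
  hence a positive scalar on each bidegree.\<close>
lemma tr_herm_mult:
  fixes f :: "'n::finite zzbar_series"
  assumes "bihomogeneous m n f"
  shows "tr (herm * f) = herm * tr f + of_nat (CARD('n) + m + n) * f"
proof -
  let ?z = "\<lambda>k. mvar (Inl k) :: 'n zzbar_series" and ?zb = "\<lambda>k. mvar (Inr k) :: 'n zzbar_series"
  let ?d = "\<lambda>k. mderiv (Inl k) :: 'n zzbar_series \<Rightarrow> _" and ?db = "\<lambda>k. mderiv (Inr k) :: 'n zzbar_series \<Rightarrow> _"
  let ?g = "\<lambda>k. f + ?z k * ?d k f + ?zb k * ?db k f"
  have *: "?d j (?db j (?z k * (?zb k * f))) =
      (if j = k then ?g k else 0) + ?z k * ?zb k * ?d j (?db j f)" for j k
    by (cases "j = k") (simp_all add: mderiv_mvar_mult mderiv_add mderiv_0 distrib_left mult.assoc)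
  have "tr (herm * f) = (\<Sum>j\<in>UNIV. \<Sum>k\<in>UNIV. ?d j (?db j (?z k * (?zb k * f))))"
    by (simp only: tr_def herm_def sum_distrib_right mderiv_sum mult.assoc)
  also have "\<dots> = (\<Sum>j\<in>UNIV. ?g j + (\<Sum>k\<in>UNIV. ?z k * ?zb k * ?d j (?db j f)))"
    unfolding * by (intro sum.cong refl) (simp add: sum.distrib)
  also have "\<dots> = (\<Sum>j\<in>UNIV. ?g j) + (\<Sum>j\<in>UNIV. \<Sum>k\<in>UNIV. ?z k * ?zb k * ?d j (?db j f))"
    by (rule sum.distrib)
  also have "(\<Sum>j\<in>UNIV. \<Sum>k\<in>UNIV. ?z k * ?zb k * ?d j (?db j f)) = herm * tr f"
    unfolding herm_def tr_def sum_product by (rule sum.swap)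
  also have "(\<Sum>j\<in>UNIV. ?g j) = of_nat (CARD('n) + m + n) * f"
    by (simp only: sum.distrib euler[OF assms] mconst_of_nat sum_constant of_nat_add distrib_right)
  finally show ?thesis by (simp only: add.commute)
qed

lemma of_nat_mult_mconst_inverse:
  fixes X :: "('v::finite, 'a::field_char_0) mfps"
  assumes "c > 0"
  shows "of_nat c * (mconst (1 / of_nat c) * X) = X"
  using assms
  by (simp add: mconst_of_nat[symmetric] mult.assoc[symmetric] mconst_mult[symmetric] mconst_1)

lemma of_nat_mult_mfps_eq_0:
  fixes X :: "('v::finite, 'a::field_char_0) mfps"
  assumes "c > 0" "of_nat c * X = 0"
  shows "X = 0"
  using of_nat_mult_mconst_inverse[OF assms(1), of X] assms(2)
  by (metis mult.left_commute mult_zero_right)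

text \<open>For bijectivity in bidegree \<open>(m, n)\<close> it suffices to find \<open>X = tr Q\<close>, since then
  \<open>Q = (P - \<langle>z, z\<rangle> X) / c\<close>.  Applying \<open>tr\<close> to the equation and commuting it past \<open>\<langle>z, z\<rangle>\<close> gives an equation of the same
  form for \<open>X\<close> in bidegree \<open>(m - 1, n - 1)\<close>, with a larger constant.\<close>

lemma herm_tr_plus_const_bijective:
  fixes P Q :: "'n::finite zzbar_series"
  assumes "c > 0" "bihomogeneous m n P"
  shows "\<exists>Q. bihomogeneous m n Q \<and> herm * tr Q + of_nat c * Q = P"
    and "herm * tr P + of_nat c * P = 0 \<Longrightarrow> P = 0"
  using assms
proof (induction m arbitrary: n c P)
  case 0
  {
    case 1
    then show ?case
      by (intro exI[of _ "mconst (1 / of_nat c) * P"])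
         (auto simp: bihomogeneous_mconst_mult tr_mconst_mult of_nat_mult_mconst_inverse tr_bihomogeneous_0[of 0 n P])
  next
    case 2
    then show ?case using of_nat_mult_mfps_eq_0[of c P] tr_bihomogeneous_0[of 0 n P] by simp
  }
next
  case (Suc m)
  {
    case 1
    show ?case
    proof (cases n)
      case 0
      then show ?thesis using 1
        by (intro exI[of _ "mconst (1 / of_nat c) * P"])
           (auto simp: bihomogeneous_mconst_mult tr_mconst_mult of_nat_mult_mconst_inverse tr_bihomogeneous_0[of "Suc m" 0 P])
    next
      case n: (Suc n')
      have "bihomogeneous m n' (tr P)" using 1 n by (simp add: bihomogeneous_tr)
      from Suc.IH(1)[OF _ this, of "CARD('n) + m + n' + c"] 1
      obtain X where X: "bihomogeneous m n' X"
        "herm * tr X + of_nat (CARD('n) + m + n' + c) * X = tr P" by auto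
      then have tr: "tr (herm * X) + of_nat c * X = tr P"
        by (simp add: tr_herm_mult algebra_simps)
      let ?Q = "mconst (1 / of_nat c) * (P - herm * X)"
      have "bihomogeneous (Suc m) n ?Q"
        using 1 n bihomogeneous_herm_mult[OF X(1)]
        by (intro bihomogeneous_mconst_mult bihomogeneous_diff) simp_all
      moreover have "tr ?Q = mconst (1 / of_nat c) * (of_nat c * X)"
        by (simp add: tr_mconst_mult tr_diff tr[symmetric])
      then have "tr ?Q = X" using of_nat_mult_mconst_inverse[of c X] 1 by (simp add: mult.left_commute)
      then have "herm * tr ?Q + of_nat c * ?Q = P" using 1 by (simp add: of_nat_mult_mconst_inverse)
      ultimately show ?thesis by blast
    qed
  next
    case 2
    have "tr P = 0"
    proof (cases n)
      case 0
      then show ?thesis using 2 tr_bihomogeneous_0 by blast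
    next
      case n: (Suc n')
      then have P': "bihomogeneous m n' (tr P)" using 2 by (simp add: bihomogeneous_tr)
      have "tr (herm * tr P + mconst (of_nat c) * P) = 0" using 2 by (simp add: tr_0 mconst_of_nat)
      then have "herm * tr (tr P) + of_nat (CARD('n) + m + n' + c) * tr P = 0"
        using P' unfolding tr_add tr_mconst_mult by (simp add: tr_herm_mult mconst_of_nat algebra_simps)
      then show ?thesis by (rule Suc.IH(2)[OF _ _ P']) simp
    qed
    then show ?case using 2 of_nat_mult_mfps_eq_0[of c P] by simp
  }
qed

lemma tr_herm_power_Suc_mult:
  fixes f :: "'n::finite zzbar_series"
  assumes "bihomogeneous m n f"
  shows "tr (herm ^ Suc k * f) =
    herm ^ k * (herm * tr f + of_nat (Suc k * (CARD('n) + m + n + k)) * f)"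
proof (induction k)
  case 0
  show ?case using tr_herm_mult[OF assms] by simp
next
  case (Suc k)
  have "tr (herm ^ Suc (Suc k) * f) =
      herm * tr (herm ^ Suc k * f) + of_nat (CARD('n) + (m + Suc k) + (n + Suc k)) * (herm ^ Suc k * f)"
    using tr_herm_mult[OF bihomogeneous_herm_power_mult[OF assms, of "Suc k"]] by (simp add: mult.assoc)
  also have "\<dots> = herm ^ Suc k * (herm * tr f + of_nat (Suc (Suc k) * (CARD('n) + m + n + Suc k)) * f)"
    unfolding Suc by (simp add: algebra_simps)
  finally show ?case .
qed

text \<open>Moving the traces one at a time past \<open>\<langle>z, z\<rangle>\<^sup>k\<close> turns \<open>tr\<^sup>k \<circ> \<langle>z, z\<rangle>\<^sup>k\<close> into a product of \<open>k\<close> operators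
  \<open>\<langle>z, z\<rangle> tr + c\<close> with \<open>c > 0\<close>, each of which is bijective.\<close>
lemma funpow_tr_herm_power_bijective:
  fixes P :: "'n::finite zzbar_series"
  assumes "bihomogeneous m n P"
  shows "\<exists>Q. bihomogeneous m n Q \<and> (tr ^^ k) (herm ^ k * Q) = P"
    and "(tr ^^ k) (herm ^ k * P) = 0 \<Longrightarrow> P = 0"
  using assms
proof (induction k arbitrary: P)
  case (Suc k)
  let ?c = "Suc k * (CARD('n) + m + n + k)"
  have c: "?c > 0" by simp
  have step: "(tr ^^ Suc k) (herm ^ Suc k * Q) = (tr ^^ k) (herm ^ k * (herm * tr Q + of_nat ?c * Q))"
    if "bihomogeneous m n Q" for Q :: "'n zzbar_series"
    unfolding funpow_Suc_right o_def tr_herm_power_Suc_mult[OF that] ..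
  {
    case 1
    from Suc.IH(1)[OF this] obtain R where R: "bihomogeneous m n R" "(tr ^^ k) (herm ^ k * R) = P" by blast
    from herm_tr_plus_const_bijective(1)[OF c R(1)] obtain Q where
      Q: "bihomogeneous m n Q" "herm * tr Q + of_nat ?c * Q = R" by blast
    then show ?case using R step[OF Q(1)] by (intro exI[of _ Q]) simp
  next
    case 2
    have "bihomogeneous m n (herm * tr P + of_nat ?c * P)"
    proof (cases "m = 0 \<or> n = 0")
      case True
      then show ?thesis using 2 tr_bihomogeneous_0[of m n P] bihomogeneous_mconst_mult[of m n P "of_nat ?c"]
        by (simp only: mconst_of_nat mult_zero_right add_0)
    next
      case False
      then obtain m' n' where mn: "m = Suc m'" "n = Suc n'" by (metis not0_implies_Suc)
      then have "bihomogeneous m n (herm * tr P)"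
        using bihomogeneous_herm_mult[OF bihomogeneous_tr, of m' n' P] 2 by simp
      then show ?thesis using 2 bihomogeneous_mconst_mult[of m n P "of_nat ?c"]
        by (intro bihomogeneous_add) (simp_all only: mconst_of_nat)
    qed
    then have "herm * tr P + of_nat ?c * P = 0" using Suc.IH(2) 2 step[of P] by metis
    then show ?case using herm_tr_plus_const_bijective(2)[OF c] 2 by blast
  }
qed simp_all

text \<open>Multiples of \<open>\<langle>z, z\<rangle>\<^sup>k\<close> form a complement of the kernel of \<open>tr\<^sup>k\<close>.  Here is the existence of the splitting;
  its uniqueness is the injectivity above.\<close>
lemma Fischer_decomposition:
  assumes "bihomogeneous (m + k) (n + k) P"
  shows "\<exists>Q. bihomogeneous m n Q \<and> (tr ^^ k) (herm ^ k * Q + P) = 0"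
proof -
  have "bihomogeneous m n (- (tr ^^ k) P)"
    using assms by (intro bihomogeneous_uminus bihomogeneous_funpow_tr)
  from funpow_tr_herm_power_bijective(1)[OF this, of k] show ?thesis
    by (metis add.left_inverse funpow_tr_add)
qed

section \<open>Bihomogeneous components\<close>

lift_definition bihom_part :: "nat \<Rightarrow> nat \<Rightarrow> 'n::finite zzbar_series \<Rightarrow> 'n zzbar_series"
  is "\<lambda>m n f \<alpha>. if zdeg \<alpha> = m \<and> zbardeg \<alpha> = n then f \<alpha> else 0" .

lemma bihomogeneous_bihom_part [simp]: "bihomogeneous m n (bihom_part m n f)"
  by (simp add: bihomogeneous_iff bihom_part.rep_eq)

lemma bihom_part_add: "bihom_part m n (f + g) = bihom_part m n f + bihom_part m n g"
  and bihom_part_diff: "bihom_part m n (f - g) = bihom_part m n f - bihom_part m n g"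
  and bihom_part_uminus: "bihom_part m n (- f) = - bihom_part m n f"
  and bihom_part_0: "bihom_part m n 0 = 0"
  by (rule mfps_eqI, simp add: bihom_part.rep_eq mcoeff_simps)+

lemma bihom_part_sum: "bihom_part m n (sum f A) = (\<Sum>x\<in>A. bihom_part m n (f x))"
  by (induction A rule: infinite_finite_induct) (simp_all add: bihom_part_add bihom_part_0)

lemma mfps_eqI_bihom_part:
  assumes "\<And>m n. bihom_part m n f = bihom_part m n g"
  shows "f = g"
proof (rule mfps_eqI)
  fix \<alpha>
  show "mcoeff f \<alpha> = mcoeff g \<alpha>"
    using arg_cong[OF assms, of "\<lambda>h. mcoeff h \<alpha>" "zdeg \<alpha>" "zbardeg \<alpha>"] by (simp add: bihom_part.rep_eq)
qed

lemma ord_ge_iff_bihom_part: "ord_ge T f \<longleftrightarrow> (\<forall>m n. m + n < T \<longrightarrow> bihom_part m n f = 0)"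
proof
  assume "ord_ge T f"
  then show "\<forall>m n. m + n < T \<longrightarrow> bihom_part m n f = 0"
    by (auto intro!: mfps_eqI simp: bihom_part.rep_eq order_ge_def mdeg_eq mcoeff_simps)
next
  assume *: "\<forall>m n. m + n < T \<longrightarrow> bihom_part m n f = 0"
  show "ord_ge T f"
    unfolding order_ge_def mdeg_eq
  proof (intro allI impI)
    fix \<alpha> :: "nat ^ ('a + 'a)" assume "zdeg \<alpha> + zbardeg \<alpha> < T"
    then have "mcoeff (bihom_part (zdeg \<alpha>) (zbardeg \<alpha>) f) \<alpha> = 0" using * by (simp add: mcoeff_simps)
    then show "mcoeff f \<alpha> = 0" by (simp add: bihom_part.rep_eq)
  qed
qed

lemma bihom_part_mult:
  assumes "bihomogeneous m' n' g"
  shows "bihom_part m n (f * g) = (if m' \<le> m \<and> n' \<le> n then bihom_part (m - m') (n - n') f * g else 0)"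
proof (rule mfps_eqI)
  fix \<alpha>
  let ?r = "if m' \<le> m \<and> n' \<le> n then bihom_part (m - m') (n - n') f * g else 0"
  show "mcoeff (bihom_part m n (f * g)) \<alpha> = mcoeff ?r \<alpha>"
  proof (cases "zdeg \<alpha> = m \<and> zbardeg \<alpha> = n")
    case False
    have "bihomogeneous m n ?r"
      using bihomogeneous_mult[OF bihomogeneous_bihom_part assms, of "m - m'" "n - n'" f] by auto
    then have "mcoeff ?r \<alpha> = 0" using False unfolding bihomogeneous_iff by blast
    then show ?thesis using False by (auto simp: bihom_part.rep_eq)
  next
    case True
    have *: "mcoeff f (fst p) * mcoeff g (snd p) =
        (if m' \<le> m \<and> n' \<le> n then mcoeff (bihom_part (m - m') (n - n') f) (fst p) * mcoeff g (snd p) else 0)"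
      if "fst p + snd p = \<alpha>" for p
    proof (cases "mcoeff g (snd p) = 0")
      case False
      then have "zdeg (snd p) = m'" "zbardeg (snd p) = n'" using assms by (auto simp: bihomogeneous_iff)
      moreover have "zdeg (fst p) + zdeg (snd p) = m" "zbardeg (fst p) + zbardeg (snd p) = n"
        using True by (simp_all flip: that)
      ultimately show ?thesis by (auto simp: bihom_part.rep_eq)
    qed simp
    have "mcoeff (bihom_part m n (f * g)) \<alpha> = (\<Sum>p | fst p + snd p = \<alpha>. mcoeff f (fst p) * mcoeff g (snd p))"
      using True by (simp add: bihom_part.rep_eq mcoeff_mult)
    also have "\<dots> = (\<Sum>p | fst p + snd p = \<alpha>. if m' \<le> m \<and> n' \<le> n
        then mcoeff (bihom_part (m - m') (n - n') f) (fst p) * mcoeff g (snd p) else 0)"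
      by (intro sum.cong refl) (rule *, simp)
    also have "\<dots> = mcoeff ?r \<alpha>"
      by (cases "m' \<le> m \<and> n' \<le> n") (auto simp: mcoeff_mult mcoeff_simps)
    finally show ?thesis .
  qed
qed

section \<open>Complex conjugation\<close>

definition conj_index :: "nat ^ ('n::finite + 'n) \<Rightarrow> nat ^ ('n + 'n)" where
  "conj_index \<alpha> = (\<chi> v. \<alpha> $ (case v of Inl k \<Rightarrow> Inr k | Inr k \<Rightarrow> Inl k))"

lemma mcoeff_mconj: "mcoeff (mconj f) \<alpha> = cnj (mcoeff f (conj_index \<alpha>))"
  by (simp add: mconj.rep_eq conj_index_def)

lemma conj_index_conj_index [simp]: "conj_index (conj_index \<alpha>) = \<alpha>"
  by (simp add: conj_index_def vec_eq_iff split: sum.split)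

lemma conj_index_add: "conj_index (\<alpha> + \<beta>) = conj_index \<alpha> + conj_index \<beta>"
  by (simp add: conj_index_def vec_eq_iff)

lemma zdeg_conj_index [simp]: "zdeg (conj_index \<alpha>) = zbardeg \<alpha>"
  and zbardeg_conj_index [simp]: "zbardeg (conj_index \<alpha>) = zdeg \<alpha>"
  by (simp_all add: zdeg_def zbardeg_def conj_index_def)

lemma mconj_add: "mconj (f + g) = mconj f + mconj g"
  and mconj_diff: "mconj (f - g) = mconj f - mconj g"
  and mconj_uminus: "mconj (- f) = - mconj f"
  and mconj_0: "mconj 0 = 0"
  and mconj_mconj: "mconj (mconj f) = f"
  by (rule mfps_eqI, simp add: mcoeff_mconj mcoeff_simps)+

lemma mconj_eq_0_iff [simp]: "mconj f = 0 \<longleftrightarrow> f = 0"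
  by (metis mconj_0 mconj_mconj)

lemma mconj_sum: "mconj (sum f A) = (\<Sum>x\<in>A. mconj (f x))"
  by (induction A rule: infinite_finite_induct) (simp_all add: mconj_add mconj_0)

lemma mconj_mult: "mconj (f * g) = mconj f * mconj g"
proof (rule mfps_eqI)
  fix \<alpha>
  show "mcoeff (mconj (f * g)) \<alpha> = mcoeff (mconj f * mconj g) \<alpha>"
    unfolding mcoeff_mult mcoeff_mconj cnj_sum complex_cnj_mult
    by (rule sum.reindex_bij_witness[of _ "map_prod conj_index conj_index" "map_prod conj_index conj_index"])
       (auto simp: conj_index_add[symmetric])
qed

lemma mconj_mvar: "mconj (mvar (Inl k)) = mvar (Inr k)" "mconj (mvar (Inr k)) = mvar (Inl k)"
proof -
  have axis: "conj_index (axis (Inl k) 1) = axis (Inr k) 1"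
    by (auto simp: conj_index_def vec_eq_iff axis_def split: sum.split)
  then have *: "conj_index \<alpha> = axis (Inl k) 1 \<longleftrightarrow> \<alpha> = axis (Inr k) 1" for \<alpha>
    by (metis conj_index_conj_index)
  show "mconj (mvar (Inl k)) = mvar (Inr k)"
    by (rule mfps_eqI) (simp add: mcoeff_mconj mvar.rep_eq *)
  then show "mconj (mvar (Inr k)) = mvar (Inl k)" by (metis mconj_mconj)
qed

lemma mconj_herm: "mconj herm = herm"
  by (simp add: herm_def mconj_sum mconj_mult mconj_mvar mult.commute)

lemma mconj_1: "mconj 1 = 1"
  using mconj_mult[of 1 "mconj 1"] by (simp add: mconj_mconj)

lemma mconj_herm_power: "mconj (herm ^ k) = herm ^ k"
  by (induction k) (simp_all add: mconj_mult mconj_herm mconj_1)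

lemma bihom_part_mconj: "bihom_part m n (mconj f) = mconj (bihom_part n m f)"
  by (rule mfps_eqI) (simp add: bihom_part.rep_eq mcoeff_mconj)

lemma bihomogeneous_mconj: "bihomogeneous m n f \<Longrightarrow> bihomogeneous n m (mconj f)"
  by (auto simp: bihomogeneous_iff mcoeff_mconj)

lemma ord_ge_mconj: "ord_ge T f \<Longrightarrow> ord_ge T (mconj f)"
  by (simp add: order_ge_def mcoeff_mconj mdeg_eq add.commute)

section \<open>Restriction to the model quadric\<close>

text \<open>On the quadric \<open>w = \<langle>z, z\<rangle>\<close> the variable \<open>w\<close> has degree 2.\<close>
definition zw_weight :: "'n option \<Rightarrow> nat" where
  "zw_weight v = (case v of Some k \<Rightarrow> 1 | None \<Rightarrow> 2)"

definition zw_zdeg :: "nat ^ ('n::finite option) \<Rightarrow> nat" where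
  "zw_zdeg \<beta> = (\<Sum>k\<in>UNIV. \<beta> $ Some k)"

text \<open>Coefficients of series in \<open>(z, w)\<close> are compared with those of polynomials in \<open>z\<close> alone, the latter being
  regarded as series in \<open>(z, conj z)\<close> of bidegree \<open>(a, 0)\<close>.  The next two functions translate the indices.\<close>
definition z_part :: "nat ^ ('n::finite option) \<Rightarrow> nat ^ ('n + 'n)" where
  "z_part \<beta> = (\<chi> v. case v of Inl k \<Rightarrow> \<beta> $ Some k | Inr k \<Rightarrow> 0)"

definition zw_index :: "nat ^ ('n::finite + 'n) \<Rightarrow> nat \<Rightarrow> nat ^ ('n option)" where
  "zw_index \<alpha> b = (\<chi> v. case v of Some k \<Rightarrow> \<alpha> $ Inl k | None \<Rightarrow> b)"

lemma wdeg_zw: "wdeg \<omega> \<beta> = (\<Sum>k\<in>UNIV. \<omega> (Some k) * \<beta> $ Some k) + \<omega> None * \<beta> $ None"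
  unfolding wdeg_def UNIV_option_conv by (simp add: sum.reindex)

lemma wdeg_zw_weight: "wdeg zw_weight \<beta> = zw_zdeg \<beta> + 2 * \<beta> $ None"
  by (simp add: wdeg_zw zw_weight_def zw_zdeg_def)

lemma mdeg_zw: "mdeg \<beta> = zw_zdeg \<beta> + \<beta> $ None"
  by (simp add: wdeg_zw zw_zdeg_def)

lemma zw_weight_ge_1: "zw_weight v \<ge> 1"
  by (simp add: zw_weight_def split: option.split)

lemma zdeg_z_part [simp]: "zdeg (z_part \<beta>) = zw_zdeg \<beta>"
  and zbardeg_z_part [simp]: "zbardeg (z_part \<beta>) = 0"
  by (simp_all add: zdeg_def zbardeg_def z_part_def zw_zdeg_def)

lemma zw_zdeg_zw_index [simp]: "zw_zdeg (zw_index \<alpha> b) = zdeg \<alpha>"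
  and zw_index_None [simp]: "zw_index \<alpha> b $ None = b"
  by (simp_all add: zdeg_def zw_index_def zw_zdeg_def)

lemma zw_index_z_part [simp]: "zw_index (z_part \<beta>) (\<beta> $ None) = \<beta>"
  by (simp add: zw_index_def z_part_def vec_eq_iff split: option.split)

lemma z_part_zw_index: "zbardeg \<alpha> = 0 \<Longrightarrow> z_part (zw_index \<alpha> b) = \<alpha>"
  by (auto simp: zw_index_def z_part_def zbardeg_def vec_eq_iff split: sum.split)

text \<open>If \<open>g = \<Sum> g\<^sub>a\<^sub>b(z) w\<^sup>b\<close> with \<open>g\<^sub>a\<^sub>b\<close> homogeneous of degree \<open>a\<close>, this is \<open>g\<^sub>a\<^sub>b\<close>.\<close>

lift_definition zw_slice :: "nat \<Rightarrow> nat \<Rightarrow> 'n::finite zw_series \<Rightarrow> 'n zzbar_series"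
  is "\<lambda>a b g \<alpha>. if zdeg \<alpha> = a \<and> zbardeg \<alpha> = 0 then g (zw_index \<alpha> b) else 0" .

lemma bihomogeneous_zw_slice: "bihomogeneous a 0 (zw_slice a b g)"
  by (simp add: bihomogeneous_iff zw_slice.rep_eq)

lemma mcoeff_zw_slice_z_part: "mcoeff (zw_slice (zw_zdeg \<beta>) (\<beta> $ None) g) (z_part \<beta>) = mcoeff g \<beta>"
  by (simp add: zw_slice.rep_eq)

lift_definition of_zw_slices :: "(nat \<Rightarrow> nat \<Rightarrow> 'n::finite zzbar_series) \<Rightarrow> 'n zw_series"
  is "\<lambda>P \<beta>. P (zw_zdeg \<beta>) (\<beta> $ None) (z_part \<beta>)" .

lemma zw_slice_of_zw_slices:
  "bihomogeneous a 0 (P a b) \<Longrightarrow> zw_slice a b (of_zw_slices P) = P a b"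
  by (rule mfps_eqI) (auto simp: zw_slice.rep_eq of_zw_slices.rep_eq z_part_zw_index bihomogeneous_iff)

lemma finite_zw_slice: "finite {\<beta> :: nat ^ ('n::finite option). zw_zdeg \<beta> = a \<and> \<beta> $ None = b}"
  by (rule finite_subset[OF _ finite_mdeg_le[of "a + b"]]) (auto simp: mdeg_zw)

lemma zw_slice_eq_sum:
  "zw_slice a b g = (\<Sum>\<beta> | zw_zdeg \<beta> = a \<and> \<beta> $ None = b. mconst (mcoeff g \<beta>) * mmonom (z_part \<beta>))"
proof (rule mfps_eqI)
  fix \<alpha> :: "nat ^ ('a + 'a)"
  have *: "zw_zdeg \<beta> = a \<and> \<beta> $ None = b \<and> \<alpha> = z_part \<beta> \<longleftrightarrow>
      \<beta> = zw_index \<alpha> b \<and> zdeg \<alpha> = a \<and> zbardeg \<alpha> = 0" for \<beta>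
    using z_part_zw_index[of \<alpha> b] zw_index_z_part[of \<beta>] by (metis zdeg_z_part zbardeg_z_part zw_zdeg_zw_index zw_index_None)
  have "mcoeff (\<Sum>\<beta> | zw_zdeg \<beta> = a \<and> \<beta> $ None = b. mconst (mcoeff g \<beta>) * mmonom (z_part \<beta>)) \<alpha> =
      (\<Sum>\<beta> | zw_zdeg \<beta> = a \<and> \<beta> $ None = b. if \<alpha> = z_part \<beta> then mcoeff g \<beta> else 0)"
    unfolding mcoeff_sum mcoeff_mconst_mult by (intro sum.cong) (auto simp: mmonom.rep_eq)
  also have "\<dots> = (\<Sum>\<beta> | zw_zdeg \<beta> = a \<and> \<beta> $ None = b \<and> \<alpha> = z_part \<beta>. mcoeff g \<beta>)"
    by (subst sum.inter_filter[symmetric]) (simp_all add: finite_zw_slice conj_assoc)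
  also have "\<dots> = mcoeff (zw_slice a b g) \<alpha>"
    unfolding * zw_slice.rep_eq by (cases "zdeg \<alpha> = a \<and> zbardeg \<alpha> = 0") auto
  finally show "mcoeff (zw_slice a b g) \<alpha> =
    mcoeff (\<Sum>\<beta> | zw_zdeg \<beta> = a \<and> \<beta> $ None = b. mconst (mcoeff g \<beta>) * mmonom (z_part \<beta>)) \<alpha>" ..
qed

lemma bihomogeneous_mmonom: "bihomogeneous (zdeg \<gamma>) (zbardeg \<gamma>) (mmonom \<gamma>)"
  by (simp add: bihomogeneous_iff mmonom.rep_eq)

lemma restrict_monomial:
  "(\<Prod>v\<in>UNIV. (case v of Some k \<Rightarrow> mvar (Inl k) | None \<Rightarrow> \<rho>) ^ (\<beta> $ v)) =
   mmonom (z_part \<beta>) * (\<rho> :: 'n::finite zzbar_series) ^ (\<beta> $ None)"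
proof -
  have "(\<Prod>v\<in>UNIV. (case v of Some k \<Rightarrow> mvar (Inl k) | None \<Rightarrow> \<rho>) ^ (\<beta> $ v)) =
      \<rho> ^ (\<beta> $ None) * (\<Prod>k\<in>UNIV. mvar (Inl k) ^ (\<beta> $ Some k))"
    unfolding UNIV_option_conv by (simp add: prod.reindex)
  also have "(\<Prod>k\<in>UNIV. mvar (Inl k) ^ (\<beta> $ Some k)) = (mmonom (\<Sum>k\<in>UNIV. axis (Inl k) (\<beta> $ Some k)) :: 'n zzbar_series)"
    by (rule prod_mvar_power_eq_mmonom) auto
  also have "(\<Sum>k\<in>UNIV. axis (Inl k) (\<beta> $ Some k)) = z_part \<beta>"
    by (auto simp: vec_eq_iff z_part_def axis_def if_distrib[of "\<lambda>x. x = _"] split: sum.split)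
  finally show ?thesis by (simp add: mult.commute)
qed

lemma ord_ge_bihomogeneous: "bihomogeneous m n f \<Longrightarrow> T \<le> m + n \<Longrightarrow> ord_ge T f"
  by (auto simp: bihomogeneous_iff order_ge_def mdeg_eq)

lemma ord_ge_herm: "ord_ge 2 herm"
  using ord_ge_bihomogeneous[OF bihomogeneous_herm, of 2] by simp

lemma restrict_to_close:
  assumes "order_ge zw_weight T f" "close d 2 \<rho> \<rho>'"
  shows "close d T (restrict_to f \<rho>) (restrict_to f \<rho>')"
  unfolding restrict_to_def
  using zw_weight_ge_1 _ assms(1)
proof (rule msubst_close)
  fix v :: "'a option"
  show "close d (zw_weight v) (case v of Some k \<Rightarrow> mvar (Inl k) | None \<Rightarrow> \<rho>)
      (case v of Some k \<Rightarrow> mvar (Inl k) | None \<Rightarrow> \<rho>')"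
    using assms(2) ord_ge_mvar by (auto simp: zw_weight_def close_def split: option.split)
qed

lemma close_refl: "ord_ge a x \<Longrightarrow> close d a x x"
  by (simp add: close_def)

lemma ord_ge_restrict_to: "order_ge zw_weight T f \<Longrightarrow> ord_ge 2 \<rho> \<Longrightarrow> ord_ge T (restrict_to f \<rho>)"
  using restrict_to_close[OF _ close_refl] by (simp add: close_def)

lemma ord_ge_1_restrict:
  assumes "ord_ge 2 \<rho>"
  shows "ord_ge 1 (case v of Some k \<Rightarrow> mvar (Inl k) | None \<Rightarrow> \<rho>)"
  using assms ord_ge_mvar order_ge_mono[of _ 2 \<rho> 1] by (auto split: option.split)

lemma restrict_to_add: "ord_ge 2 \<rho> \<Longrightarrow> restrict_to (f + g) \<rho> = restrict_to f \<rho> + restrict_to g \<rho>"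
  and restrict_to_diff: "ord_ge 2 \<rho> \<Longrightarrow> restrict_to (f - g) \<rho> = restrict_to f \<rho> - restrict_to g \<rho>"
  by (simp_all add: restrict_to_def ord_ge_1_restrict msubst_add msubst_diff)

text \<open>A term \<open>g\<^sub>a\<^sub>b(z) \<langle>z, z\<rangle>\<^sup>b\<close> has bidegree \<open>(a + b, b)\<close>, so each bidegree meets at most one of these terms.\<close>
lemma bihom_part_restrict_to_herm:
  fixes g :: "'n::finite zw_series"
  shows "bihom_part m n (restrict_to g herm) = (if n \<le> m then zw_slice (m - n) n g * herm ^ n else 0)"
proof (rule mfps_eqI)
  fix \<alpha> :: "nat ^ ('n + 'n)"
  let ?t = "\<lambda>\<beta>. mmonom (z_part \<beta>) * herm ^ (\<beta> $ None) :: 'n zzbar_series"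
  let ?S = "if n \<le> m then {\<beta> :: nat ^ ('n option). zw_zdeg \<beta> = m - n \<and> \<beta> $ None = n} else {}"
  have t: "bihomogeneous (zw_zdeg \<beta> + \<beta> $ None) (\<beta> $ None) (?t \<beta>)" for \<beta>
    using bihomogeneous_mult[OF bihomogeneous_mmonom bihomogeneous_herm_power, of "z_part \<beta>" "\<beta> $ None"] by simp
  have r: "(if n \<le> m then zw_slice (m - n) n g * herm ^ n else 0) = (\<Sum>\<beta>\<in>?S. mconst (mcoeff g \<beta>) * ?t \<beta>)"
    by (simp add: zw_slice_eq_sum sum_distrib_right mult.assoc)
  show "mcoeff (bihom_part m n (restrict_to g herm)) \<alpha> = mcoeff (if n \<le> m then zw_slice (m - n) n g * herm ^ n else 0) \<alpha>"
  proof (cases "zdeg \<alpha> = m \<and> zbardeg \<alpha> = n")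
    case False
    have "mcoeff (?t \<beta>) \<alpha> = 0" if "\<beta> \<in> ?S" for \<beta>
      using False that t[of \<beta>] by (auto simp: bihomogeneous_iff split: if_splits)
    then have "mcoeff (\<Sum>\<beta>\<in>?S. mconst (mcoeff g \<beta>) * ?t \<beta>) \<alpha> = 0"
      unfolding mcoeff_sum mcoeff_mconst_mult by (intro sum.neutral) simp
    then show ?thesis unfolding r using False by (auto simp: bihom_part.rep_eq)
  next
    case True
    then have "mcoeff (bihom_part m n (restrict_to g herm)) \<alpha> =
        (\<Sum>\<beta> | mdeg \<beta> \<le> m + n. mcoeff g \<beta> * mcoeff (?t \<beta>) \<alpha>)"
      unfolding restrict_to_def
      by (simp add: bihom_part.rep_eq mcoeff_msubst[OF ord_ge_1_restrict[OF ord_ge_herm], of \<alpha> "m + n"]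
          mdeg_eq restrict_monomial)
    also have "\<dots> = (\<Sum>\<beta>\<in>?S. mcoeff g \<beta> * mcoeff (?t \<beta>) \<alpha>)"
    proof (rule sum.mono_neutral_right[OF finite_mdeg_le])
      show "?S \<subseteq> {\<beta>. mdeg \<beta> \<le> m + n}" by (auto simp: mdeg_zw)
      show "\<forall>\<beta>\<in>{\<beta>. mdeg \<beta> \<le> m + n} - ?S. mcoeff g \<beta> * mcoeff (?t \<beta>) \<alpha> = 0"
      proof
        fix \<beta> assume "\<beta> \<in> {\<beta>. mdeg \<beta> \<le> m + n} - ?S"
        then have "mcoeff (?t \<beta>) \<alpha> = 0"
          using True t[of \<beta>] by (auto simp: bihomogeneous_iff split: if_splits)
        then show "mcoeff g \<beta> * mcoeff (?t \<beta>) \<alpha> = 0" by simp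
      qed
    qed
    finally show ?thesis unfolding r by (simp only: mcoeff_sum mcoeff_mconst_mult)
  qed
qed

section \<open>The linearized transformation problem\<close>

text \<open>The pairing \<open>\<langle>f(z, \<rho>), z\<rangle>\<close>.\<close>
definition herm_pairing :: "('n::finite \<Rightarrow> 'n zw_series) \<Rightarrow> 'n zzbar_series \<Rightarrow> 'n zzbar_series" where
  "herm_pairing f \<rho> = (\<Sum>k\<in>UNIV. restrict_to (f k) \<rho> * mvar (Inr k))"

text \<open>The normalizations expressed by coefficients of the unknowns \<open>f = F - z\<close>, \<open>g = G - w\<close> and
  \<open>p = \<rho>' - \<langle>z, z\<rangle>\<close>.  In this form they visibly define real vector spaces.  The conditions on \<open>f\<close> combine
  \<open>m + n \<ge> 2\<close> with the vanishing of \<open>F\<^sub>0\<^sub>,\<^sub>n\<^sub>+\<^sub>1\<close> and \<open>F\<^sub>1\<^sub>,\<^sub>n\<close>.\<close>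
definition normal_map :: "('n::finite \<Rightarrow> 'n zw_series) \<Rightarrow> 'n zw_series \<Rightarrow> bool" where
  "normal_map f g \<longleftrightarrow> (\<forall>k \<beta>. zw_zdeg \<beta> \<le> 1 \<longrightarrow> mcoeff (f k) \<beta> = 0) \<and>
     (\<forall>\<beta>. zw_zdeg \<beta> + \<beta> $ None \<le> 1 \<longrightarrow> mcoeff g \<beta> = 0)"

definition normal_form :: "'n::finite zzbar_series \<Rightarrow> bool" where
  "normal_form p \<longleftrightarrow> ord_ge 3 p \<and>
     (\<forall>m n. 1 \<le> m \<and> m < n \<longrightarrow> (tr ^^ (m - 1)) (bihom_part m n p) = 0) \<and>
     (\<forall>m n. 1 \<le> n \<and> n \<le> m \<longrightarrow> (tr ^^ n) (bihom_part m n p) = 0) \<and>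
     (\<forall>m. bihom_part 0 m p = mconj (bihom_part m 0 p))"

definition linear_part :: "('n::finite \<Rightarrow> 'n zw_series) \<Rightarrow> 'n zw_series \<Rightarrow> 'n zzbar_series \<Rightarrow> 'n zzbar_series" where
  "linear_part f g p = restrict_to g herm - p - (herm_pairing f herm + mconj (herm_pairing f herm))"

lemma normal_formD:
  assumes "normal_form p"
  shows "ord_ge 3 p"
    and "1 \<le> m \<Longrightarrow> m < n \<Longrightarrow> (tr ^^ (m - 1)) (bihom_part m n p) = 0"
    and "1 \<le> n \<Longrightarrow> n \<le> m \<Longrightarrow> (tr ^^ n) (bihom_part m n p) = 0"
    and "bihom_part 0 m p = mconj (bihom_part m 0 p)"
  using assms unfolding normal_form_def by blast+

lemma normal_map_diff:
  "normal_map f g \<Longrightarrow> normal_map f' g' \<Longrightarrow> normal_map (\<lambda>k. f k - f' k) (g - g')"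
  by (simp add: normal_map_def mcoeff_simps)

lemma normal_form_diff: "normal_form p \<Longrightarrow> normal_form p' \<Longrightarrow> normal_form (p - p')"
  by (simp add: normal_form_def bihom_part_diff funpow_tr_diff mconj_diff order_ge_diff)

lemma herm_pairing_diff:
  "ord_ge 2 \<rho> \<Longrightarrow> herm_pairing (\<lambda>k. f k - f' k) \<rho> = herm_pairing f \<rho> - herm_pairing f' \<rho>"
  by (simp add: herm_pairing_def restrict_to_diff left_diff_distrib sum_subtractf)

lemma linear_part_diff: "linear_part (\<lambda>k. f k - f' k) (g - g') (p - p') = linear_part f g p - linear_part f' g' p'"
  by (simp add: linear_part_def restrict_to_diff herm_pairing_diff ord_ge_herm mconj_diff)

lemma normal_map_order:
  assumes "normal_map f g"
  shows "order_ge zw_weight 2 (f k)" "order_ge zw_weight 2 g"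
  using assms by (auto simp: normal_map_def order_ge_def wdeg_zw_weight)

lemma ord_ge_herm_pairing:
  assumes "\<And>k. order_ge zw_weight T (f k)" "ord_ge 2 \<rho>"
  shows "ord_ge (T + 1) (herm_pairing f \<rho>)"
  unfolding herm_pairing_def
  by (intro order_ge_sum order_ge_mult ord_ge_restrict_to assms ord_ge_mvar)

text \<open>The part of \<open>\<langle>f(z, \<langle>z, z\<rangle>), z\<rangle>\<close> of bidegree \<open>(a + b, b + 1)\<close>, divided by \<open>\<langle>z, z\<rangle>\<^sup>b\<close>.\<close>

definition herm_pairing_slice :: "nat \<Rightarrow> nat \<Rightarrow> ('n::finite \<Rightarrow> 'n zw_series) \<Rightarrow> 'n zzbar_series" where
  "herm_pairing_slice a b f = (\<Sum>k\<in>UNIV. zw_slice a b (f k) * mvar (Inr k))"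

lemma bihomogeneous_herm_pairing_slice: "bihomogeneous a 1 (herm_pairing_slice a b f)"
  unfolding herm_pairing_slice_def
  using bihomogeneous_mult[OF bihomogeneous_zw_slice bihomogeneous_mvar(2)]
  by (intro bihomogeneous_sum) simp

text \<open>The components of the vector \<open>F\<^sub>a\<^sub>b\<close> are recovered from \<open>\<langle>F\<^sub>a\<^sub>b(z), z\<rangle>\<close>, which is linear in \<open>conj z\<close>.\<close>
lemma mderiv_herm_pairing_slice: "mderiv (Inr k) (herm_pairing_slice a b f) = zw_slice a b (f k)"
proof -
  have "mderiv (Inr k) (zw_slice a b (f j) * mvar (Inr j)) = (if k = j then zw_slice a b (f j) else 0)" for j
    using mderiv_mvar_mult[of "Inr k" "Inr j" "zw_slice a b (f j)"]
    by (simp add: mult.commute mderiv_bihomogeneous_0(2)[OF bihomogeneous_zw_slice])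
  then show ?thesis by (simp add: herm_pairing_slice_def mderiv_sum)
qed

text \<open>In the bidegree \<open>(a + b, b + 1)\<close> of \<open>\<langle>F\<^sub>a\<^sub>b(z), z\<rangle> \<langle>z, z\<rangle>\<^sup>b\<close> the first entry is the larger one because the
  normalization leaves only \<open>a \<ge> 2\<close>.  Hence this pairing and its conjugate never meet in the same bidegree.\<close>
lemma bihom_part_herm_pairing:
  assumes "normal_map f g"
  shows "bihom_part m n (herm_pairing f herm) =
    (if 1 \<le> n \<and> n < m then herm_pairing_slice (m + 1 - n) (n - 1) f * herm ^ (n - 1) else 0)"
proof -
  have 0: "zw_slice a b (f k) = 0" if "a \<le> 1" for a b k
    using assms that by (auto intro!: mfps_eqI simp: zw_slice.rep_eq normal_map_def mcoeff_simps)
  have *: "bihom_part m n (restrict_to (f k) herm * mvar (Inr k)) =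
      (if 1 \<le> n \<and> n < m then zw_slice (m + 1 - n) (n - 1) (f k) * mvar (Inr k) * herm ^ (n - 1) else 0)" for k
  proof -
    have "m - (n - 1) = m + 1 - n" if "1 \<le> n" using that by simp
    moreover have "zw_slice (m + 1 - n) (n - 1) (f k) = 0" if "\<not> n < m" by (rule 0) (use that in simp)
    ultimately show ?thesis
      unfolding bihom_part_mult[OF bihomogeneous_mvar(2)] bihom_part_restrict_to_herm
      by (auto simp: mult.assoc mult.commute[of "mvar _"])
  qed
  show ?thesis
    unfolding herm_pairing_def bihom_part_sum * herm_pairing_slice_def sum_distrib_right
    by (cases "1 \<le> n \<and> n < m") (simp_all only: if_True if_False sum.neutral_const simp_thms)
qed

lemma bihom_part_linear_part:
  assumes "normal_map f g"
  shows bihom_part_linear_part_below: "1 \<le> m \<Longrightarrow> m < n \<Longrightarrow> bihom_part m n (linear_part f g p) =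
      - (herm ^ (m - 1) * mconj (herm_pairing_slice (n + 1 - m) (m - 1) f) + bihom_part m n p)"
    and bihom_part_linear_part_above: "1 \<le> n \<Longrightarrow> n < m \<Longrightarrow> bihom_part m n (linear_part f g p) =
      herm ^ n * zw_slice (m - n) n g - bihom_part m n p - herm_pairing_slice (m + 1 - n) (n - 1) f * herm ^ (n - 1)"
    and bihom_part_linear_part_diag: "bihom_part m m (linear_part f g p) = herm ^ m * zw_slice 0 m g - bihom_part m m p"
    and bihom_part_linear_part_z: "bihom_part m 0 (linear_part f g p) = zw_slice m 0 g - bihom_part m 0 p"
    and bihom_part_linear_part_zbar: "1 \<le> n \<Longrightarrow> bihom_part 0 n (linear_part f g p) = - bihom_part 0 n p"
  unfolding linear_part_def
  by (simp_all add: bihom_part_diff bihom_part_add bihom_part_mconj bihom_part_restrict_to_herm bihom_part_herm_pairing[OF assms]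
      mconj_mult mconj_herm_power mconj_0 mult.commute)

text \<open>Injectivity in each degree.  The bidegrees are treated in the order in which the
  unknowns separate: \<open>m < n\<close> for \<open>f\<close>, then \<open>n \<le> m\<close> for \<open>g\<close>, then the pure terms.
  In the first two cases the trace condition on \<open>p\<close> removes the multiple of \<open>\<langle>z, z\<rangle>\<close>.  The orders
  of \<open>f\<close> and \<open>g\<close> differ by one because \<open>f\<close> is paired with \<open>z\<close>.\<close>
lemma linear_part_injective:
  assumes fg: "normal_map f g" and p: "normal_form p" and T: "ord_ge T (linear_part f g p)"
  shows "order_ge zw_weight (T - 1) (f k)" "order_ge zw_weight T g" "ord_ge T p"
proof -
  have L: "bihom_part m n (linear_part f g p) = 0" if "m + n < T" for m n
    using T that by (simp add: ord_ge_iff_bihom_part)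
  have below: "herm_pairing_slice (n + 1 - m) (m - 1) f = 0" "bihom_part m n p = 0"
    if mn: "1 \<le> m" "m < n" "m + n < T" for m n
  proof -
    let ?Q = "mconj (herm_pairing_slice (n + 1 - m) (m - 1) f)"
    have eq: "herm ^ (m - 1) * ?Q + bihom_part m n p = 0"
      using L[OF mn(3)] unfolding bihom_part_linear_part_below[OF fg mn(1,2)] neg_equal_0_iff_equal .
    have "(tr ^^ (m - 1)) (bihom_part m n p) = 0" using normal_formD(2)[OF p mn(1,2)] .
    then have "(tr ^^ (m - 1)) (herm ^ (m - 1) * ?Q) = 0"
      using arg_cong[OF eq, of "tr ^^ (m - 1)"] by (simp add: funpow_tr_add funpow_tr_0)
    then have "?Q = 0"
      using funpow_tr_herm_power_bijective(2)[OF bihomogeneous_mconj[OF bihomogeneous_herm_pairing_slice]] by blast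
    then show "herm_pairing_slice (n + 1 - m) (m - 1) f = 0" "bihom_part m n p = 0" using eq by (simp_all add: mconj_0)
  qed
  have above: "zw_slice (m - n) n g = 0" "bihom_part m n p = 0"
    if mn: "1 \<le> n" "n \<le> m" "m + n < T" for m n
  proof -
    have eq: "herm ^ n * zw_slice (m - n) n g - bihom_part m n p = 0"
    proof (cases "n < m")
      case True
      have "herm_pairing_slice (m + 1 - n) (n - 1) f = 0" by (rule below(1)) (use True mn in simp_all)
      then show ?thesis using L[OF mn(3)] bihom_part_linear_part_above[OF fg mn(1) True, of p] by simp
    next
      case False
      then show ?thesis using L[OF mn(3)] bihom_part_linear_part_diag[OF fg, of m p] mn by simp
    qed
    have "(tr ^^ n) (bihom_part m n p) = 0" using normal_formD(3)[OF p mn(1,2)] .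
    then have "(tr ^^ n) (herm ^ n * zw_slice (m - n) n g) = 0"
      using arg_cong[OF eq, of "tr ^^ n"] by (simp add: funpow_tr_diff funpow_tr_0)
    then have "zw_slice (m - n) n g = 0"
      using funpow_tr_herm_power_bijective(2)[OF bihomogeneous_zw_slice] by blast
    then show "zw_slice (m - n) n g = 0" "bihom_part m n p = 0" using eq by simp_all
  qed
  have zbar: "bihom_part 0 n p = 0" if "n < T" for n
  proof (cases "n = 0")
    case True
    then show ?thesis using normal_formD(1)[OF p] unfolding ord_ge_iff_bihom_part by simp
  next
    case False
    then show ?thesis using L[of 0 n] bihom_part_linear_part_zbar[OF fg, of n p] that by simp
  qed
  have z: "bihom_part m 0 p = 0" "zw_slice m 0 g = 0" if "m < T" for m
  proof -
    show 1: "bihom_part m 0 p = 0" using zbar[OF that] normal_formD(4)[OF p, of m] by simp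
    show "zw_slice m 0 g = 0" using L[of m 0] bihom_part_linear_part_z[OF fg, of m p] 1 that by simp
  qed
  show "ord_ge T p"
    unfolding ord_ge_iff_bihom_part
  proof (intro allI impI)
    fix m n :: nat assume mn: "m + n < T"
    consider "m = 0" | "n = 0" | "1 \<le> m" "m < n" | "1 \<le> n" "n \<le> m" by linarith
    then show "bihom_part m n p = 0" using mn zbar z(1) below(2) above(2) by cases auto
  qed
  show "order_ge zw_weight T g"
    unfolding order_ge_def wdeg_zw_weight
  proof (intro allI impI)
    fix \<beta> :: "nat ^ ('a option)" assume lt: "zw_zdeg \<beta> + 2 * \<beta> $ None < T"
    have "zw_slice (zw_zdeg \<beta>) (\<beta> $ None) g = 0"
    proof (cases "\<beta> $ None = 0")
      case True
      then show ?thesis using z(2)[of "zw_zdeg \<beta>"] lt by simp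
    next
      case False
      then show ?thesis using above(1)[of "\<beta> $ None" "zw_zdeg \<beta> + \<beta> $ None"] lt by simp
    qed
    then show "mcoeff g \<beta> = 0" using mcoeff_zw_slice_z_part[of \<beta> g] by (simp add: mcoeff_simps)
  qed
  show "order_ge zw_weight (T - 1) (f k)"
    unfolding order_ge_def wdeg_zw_weight
  proof (intro allI impI)
    fix \<beta> :: "nat ^ ('a option)" assume lt: "zw_zdeg \<beta> + 2 * \<beta> $ None < T - 1"
    show "mcoeff (f k) \<beta> = 0"
    proof (cases "zw_zdeg \<beta> \<le> 1")
      case True
      then show ?thesis using fg by (simp add: normal_map_def)
    next
      case False
      have "herm_pairing_slice (zw_zdeg \<beta> + \<beta> $ None + 1 - (\<beta> $ None + 1)) (\<beta> $ None + 1 - 1) f = 0"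
        by (rule below(1)) (use False lt in linarith)+
      then have "herm_pairing_slice (zw_zdeg \<beta>) (\<beta> $ None) f = 0" by simp
      then have "zw_slice (zw_zdeg \<beta>) (\<beta> $ None) (f k) = 0"
        using mderiv_herm_pairing_slice[of k "zw_zdeg \<beta>" "\<beta> $ None" f] by (simp add: mderiv_0)
      then show ?thesis using mcoeff_zw_slice_z_part[of \<beta> "f k"] by (simp add: mcoeff_simps)
    qed
  qed
qed

text \<open>The coefficients of \<open>f\<close> and \<open>g\<close> come from Fischer decompositions in the same order, and \<open>p\<close> is then whatever
  the equation requires; the choices made are what puts it into normal form.\<close>
lemma linear_part_surjective:
  fixes H :: "'n::finite zzbar_series"
  assumes H: "ord_ge 3 H"
  shows "\<exists>f g p. normal_map f g \<and> normal_form p \<and> linear_part f g p = H"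
proof -
  have "\<exists>Q. bihomogeneous 1 a Q \<and> (tr ^^ b) (herm ^ b * Q + bihom_part (1 + b) (a + b) H) = 0" for a b
    by (intro Fischer_decomposition bihomogeneous_bihom_part)
  then obtain Q where Q: "\<And>a b. bihomogeneous 1 a (Q a b)"
    "\<And>a b. (tr ^^ b) (herm ^ b * Q a b + bihom_part (1 + b) (a + b) H) = 0" by metis
  \<comment> \<open>\<open>Q a b\<close> is to be the conjugate of \<open>\<langle>F\<^sub>a\<^sub>b(z), z\<rangle>\<close>, whose \<open>k\<close>-th component is its derivative in \<open>conj z\<^sub>k\<close>.\<close>
  define f where "f k = of_zw_slices (\<lambda>a b. if a \<ge> 2 then mderiv (Inr k) (mconj (Q a b)) else 0)" for k
  have f0: "mcoeff (f k) \<beta> = 0" if "zw_zdeg \<beta> \<le> 1" for k \<beta>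
    using that by (simp add: f_def of_zw_slices.rep_eq mcoeff_simps)
  have Qc: "bihomogeneous a (Suc 0) (mconj (Q a b))" for a b
    using bihomogeneous_mconj[OF Q(1)[of a b]] by (simp add: One_nat_def)
  have f: "herm_pairing_slice a b f = mconj (Q a b)" if "a \<ge> 2" for a b
  proof -
    have "zw_slice a b (f k) = mderiv (Inr k) (mconj (Q a b))" for k
      unfolding f_def using that bihomogeneous_mderiv(2)[OF Qc] by (subst zw_slice_of_zw_slices) simp_all
    then have "herm_pairing_slice a b f = (\<Sum>k\<in>UNIV. mvar (Inr k) * mderiv (Inr k) (mconj (Q a b)))"
      by (simp add: herm_pairing_slice_def mult.commute)
    also have "\<dots> = mconj (Q a b)"
      using euler_zbar[OF Qc] by (simp add: mconst_1)
    finally show ?thesis .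
  qed
  define K where "K = H + herm_pairing f herm"
  have "\<exists>B. bihomogeneous a 0 B \<and> (tr ^^ b) (herm ^ b * B + bihom_part (a + b) (0 + b) (- K)) = 0" for a b
    by (intro Fischer_decomposition bihomogeneous_bihom_part)
  then obtain B where B: "\<And>a b. bihomogeneous a 0 (B a b)"
    "\<And>a b. (tr ^^ b) (herm ^ b * B a b - bihom_part (a + b) b K) = 0"
    by (auto simp: bihom_part_uminus) metis
  \<comment> \<open>The pure terms \<open>G\<^sub>a\<^sub>0\<close> absorb the defect from reality of the pure terms of \<open>H\<close>.\<close>
  define G where "G a b = (if a + 2 * b < 3 then 0
    else if b = 0 then bihom_part a 0 H - mconj (bihom_part 0 a H) else B a b)" for a b
  have G: "bihomogeneous a 0 (G a b)" for a b
    by (simp add: G_def B(1) bihomogeneous_diff bihomogeneous_mconj)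
  define g where "g = of_zw_slices G"
  have g: "zw_slice a b g = G a b" for a b
    unfolding g_def by (rule zw_slice_of_zw_slices[OF G])
  have g3: "order_ge zw_weight 3 g"
    by (simp add: order_ge_def wdeg_zw_weight g_def of_zw_slices.rep_eq G_def mcoeff_simps)
  have fg: "normal_map f g"
    unfolding normal_map_def
  proof (intro conjI allI impI)
    fix \<beta> :: "nat ^ ('n option)" assume "zw_zdeg \<beta> + \<beta> $ None \<le> 1"
    then have "zw_zdeg \<beta> + 2 * \<beta> $ None < 3" by simp
    then show "mcoeff g \<beta> = 0" using g3 by (simp add: order_ge_def wdeg_zw_weight)
  qed (rule f0)
  define p where "p = restrict_to g herm - (herm_pairing f herm + mconj (herm_pairing f herm)) - H"
  have linear_part: "linear_part f g p = H" by (simp add: linear_part_def p_def)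
  have p3: "ord_ge 3 p"
  proof -
    have "ord_ge (2 + 1) (herm_pairing f herm)"
      by (intro ord_ge_herm_pairing normal_map_order[OF fg] ord_ge_herm)
    then show ?thesis unfolding p_def
      by (intro order_ge_diff order_ge_add ord_ge_mconj ord_ge_restrict_to g3 ord_ge_herm H) simp_all
  qed
  have "(tr ^^ (m - 1)) (bihom_part m n p) = 0" if mn: "1 \<le> m" "m < n" for m n
  proof -
    have "1 + (m - 1) = m" "n + 1 - m + (m - 1) = n" using mn by simp_all
    moreover have "mconj (herm_pairing_slice (n + 1 - m) (m - 1) f) = Q (n + 1 - m) (m - 1)"
      using f[of "n + 1 - m" "m - 1"] mn by (simp add: mconj_mconj)
    ultimately have "bihom_part m n p = 0 - (herm ^ (m - 1) * Q (n + 1 - m) (m - 1) +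
        bihom_part (1 + (m - 1)) (n + 1 - m + (m - 1)) H)"
      using bihom_part_linear_part_below[OF fg mn, of p] unfolding linear_part by simp
    then show ?thesis by (simp only: funpow_tr_diff Q(2) funpow_tr_0 diff_self)
  qed
  moreover have "(tr ^^ n) (bihom_part m n p) = 0" if mn: "1 \<le> n" "n \<le> m" for m n
  proof (cases "m + n < 3")
    case True
    then have "bihom_part m n p = 0" using p3 by (simp add: ord_ge_iff_bihom_part)
    then show ?thesis by (simp add: funpow_tr_0)
  next
    case False
    have "bihom_part m n (mconj (herm_pairing f herm)) = 0"
      using mn by (simp add: bihom_part_mconj bihom_part_herm_pairing[OF fg] mconj_0)
    then have "bihom_part m n p = herm ^ n * zw_slice (m - n) n g - bihom_part (m - n + n) n K"
      using mn by (simp add: p_def K_def bihom_part_diff bihom_part_add bihom_part_restrict_to_herm mult.commute)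
    also have "zw_slice (m - n) n g = B (m - n) n"
      using mn False by (simp add: g G_def)
    finally show ?thesis by (simp only: B(2))
  qed
  moreover have "bihom_part 0 m p = mconj (bihom_part m 0 p)" for m
  proof (cases "m < 3")
    case True
    then show ?thesis using p3 by (simp add: ord_ge_iff_bihom_part mconj_0)
  next
    case False
    then have "bihom_part 0 m p = - bihom_part 0 m H" "bihom_part m 0 H = bihom_part m 0 H - mconj (bihom_part 0 m H) - bihom_part m 0 p"
      using bihom_part_linear_part_zbar[OF fg, of m p] bihom_part_linear_part_z[OF fg, of m p] unfolding linear_part
      by (simp_all add: g G_def)
    then have "bihom_part 0 m p = - bihom_part 0 m H" "bihom_part m 0 p = - mconj (bihom_part 0 m H)" by simp_all
    then show ?thesis by (simp only: mconj_uminus mconj_mconj)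
  qed
  ultimately have "normal_form p" using p3 unfolding normal_form_def by blast
  with fg linear_part show ?thesis by blast
qed

section \<open>Coefficient form of the normalizations\<close>

lemma mcoeff_msum_single:
  assumes "\<And>i. i \<in> I \<Longrightarrow> i \<noteq> j \<Longrightarrow> mcoeff (f i) \<alpha> = 0"
  shows "mcoeff (msum I f) \<alpha> = (if j \<in> I then mcoeff (f j) \<alpha> else 0)"
proof -
  have "{i. i \<in> I \<and> mcoeff (f i) \<alpha> \<noteq> 0} = (if j \<in> I \<and> mcoeff (f j) \<alpha> \<noteq> 0 then {j} else {})"
    using assms by auto
  then show ?thesis by (simp add: msum.rep_eq)
qed

lemma mcoeff_in_zw_mult_mvar_power:
  fixes f :: "'n::finite z_series"
  shows "mcoeff (in_zw f * mvar None ^ n) \<beta> = (if \<beta> $ None = n then mcoeff f (\<chi> k. \<beta> $ Some k) else 0)"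
proof -
  define e :: "nat ^ 'n \<Rightarrow> nat ^ ('n option)" where "e \<gamma> = (\<chi> v. case v of Some k \<Rightarrow> \<gamma> $ k | None \<Rightarrow> 0)" for \<gamma>
  have e: "(\<Sum>k\<in>UNIV. axis (Some k) (\<gamma> $ k)) = e \<gamma>" for \<gamma>
    by (auto simp: e_def vec_eq_iff axis_def split: option.split)
  have in_zw: "mcoeff (in_zw f) \<beta> = (if \<beta> $ None = 0 then mcoeff f (\<chi> k. \<beta> $ Some k) else 0)" for \<beta>
  proof -
    have "(\<Prod>v\<in>UNIV. mvar (Some v) ^ (\<gamma> $ v)) = (mmonom (e \<gamma>) :: 'n zw_series)" for \<gamma>
      unfolding e[symmetric] by (rule prod_mvar_power_eq_mmonom) auto
    then have "mcoeff (in_zw f) \<beta> = (\<Sum>\<gamma> | mdeg \<gamma> \<le> mdeg \<beta>. mcoeff f \<gamma> * mcoeff (mmonom (e \<gamma>)) \<beta>)"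
      unfolding in_zw_def by (subst mcoeff_msubst[OF ord_ge_mvar order.refl]) simp
    also have "\<dots> = (\<Sum>\<gamma> | mdeg \<gamma> \<le> mdeg \<beta>. if \<gamma> = (\<chi> k. \<beta> $ Some k) then
        if \<beta> $ None = 0 then mcoeff f \<gamma> else 0 else 0)"
    proof (intro sum.cong refl)
      fix \<gamma>
      have "\<beta> = e \<gamma> \<longleftrightarrow> \<gamma> = (\<chi> k. \<beta> $ Some k) \<and> \<beta> $ None = 0"
        by (auto simp: vec_eq_iff e_def split: option.split)
      then show "mcoeff f \<gamma> * mcoeff (mmonom (e \<gamma>)) \<beta> = (if \<gamma> = (\<chi> k. \<beta> $ Some k) then
        if \<beta> $ None = 0 then mcoeff f \<gamma> else 0 else 0)"
        by (simp add: mmonom.rep_eq)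
    qed
    also have "\<dots> = (if \<beta> $ None = 0 then mcoeff f (\<chi> k. \<beta> $ Some k) else 0)"
    proof -
      have "mdeg (\<chi> k. \<beta> $ Some k) \<le> mdeg \<beta>" unfolding mdeg_zw by (simp add: wdeg_def zw_zdeg_def)
      then show ?thesis using finite_mdeg_le by (subst sum.delta) auto
    qed
    finally show ?thesis .
  qed
  have pow: "in_zw f * mvar None ^ n = mmonom (axis None n) * in_zw f"
    by (simp only: mvar_power_eq_mmonom mult.commute)
  show ?thesis
  proof (cases "n \<le> \<beta> $ None")
    case True
    define \<beta>' where "\<beta>' = \<beta> - axis None n"
    have "\<beta> = axis None n + \<beta>'" using True by (auto simp: \<beta>'_def vec_eq_iff axis_def)
    moreover have "\<beta>' $ None = \<beta> $ None - n" "(\<chi> k. \<beta>' $ Some k) = (\<chi> k. \<beta> $ Some k)"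
      by (simp_all add: \<beta>'_def axis_def)
    ultimately show ?thesis using True unfolding pow
      by (metis mcoeff_mmonom_mult in_zw diff_is_0_eq le_antisym order.refl)
  next
    case False
    then have "\<beta> \<noteq> axis None n + \<delta>" for \<delta> by (auto simp: axis_def)
    then show ?thesis using False unfolding pow by (subst mcoeff_mmonom_mult_eq_0) auto
  qed
qed

lemma mdeg_zw_z: "mdeg (\<chi> k. \<beta> $ Some k) = zw_zdeg \<beta>"
  by (simp add: wdeg_def zw_zdeg_def)

lemma homogeneous_iff: "homogeneous m f \<longleftrightarrow> (\<forall>\<alpha>. mcoeff f \<alpha> \<noteq> 0 \<longrightarrow> mdeg \<alpha> = m)"
  by (simp add: homogeneous_def wdeg_def)

text \<open>By homogeneity, exactly one member of the family can contribute to a given coefficient.\<close>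
lemma mcoeff_zw_expansion:
  assumes "\<And>m n. homogeneous m (c m n)"
  shows "mcoeff (msum I (\<lambda>(m, n). in_zw (c m n) * mvar None ^ n)) \<beta> =
    (if (zw_zdeg \<beta>, \<beta> $ None) \<in> I then mcoeff (c (zw_zdeg \<beta>) (\<beta> $ None)) (\<chi> k. \<beta> $ Some k) else 0)"
proof (subst mcoeff_msum_single[where j = "(zw_zdeg \<beta>, \<beta> $ None)"])
  fix i assume "i \<noteq> (zw_zdeg \<beta>, \<beta> $ None)"
  then show "mcoeff (case i of (m, n) \<Rightarrow> in_zw (c m n) * mvar None ^ n) \<beta> = 0"
    using assms[of "fst i" "snd i"] mdeg_zw_z[of \<beta>]
    by (cases i) (auto simp: mcoeff_in_zw_mult_mvar_power homogeneous_iff)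
qed (simp add: mcoeff_in_zw_mult_mvar_power)

lift_definition zw_coeff :: "'n::finite zw_series \<Rightarrow> nat \<Rightarrow> nat \<Rightarrow> 'n z_series"
  is "\<lambda>g m n \<gamma>. if mdeg \<gamma> = m then g (\<chi> v. case v of Some k \<Rightarrow> \<gamma> $ k | None \<Rightarrow> n) else 0" .

lemma homogeneous_zw_coeff: "homogeneous m (zw_coeff g m n)"
  by (simp add: homogeneous_iff zw_coeff.rep_eq)

lemma zw_expansion:
  assumes "\<And>\<beta>. zw_zdeg \<beta> + \<beta> $ None \<le> 1 \<Longrightarrow> mcoeff g \<beta> = 0"
  shows "g = msum {(m, n). m + n \<ge> 2} (\<lambda>(m, n). in_zw (zw_coeff g m n) * mvar None ^ n)"
proof (rule mfps_eqI)
  fix \<beta> :: "nat ^ ('a option)"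
  have "(\<chi> v. case v of Some k \<Rightarrow> (\<chi> k. \<beta> $ Some k) $ k | None \<Rightarrow> \<beta> $ None) = \<beta>"
    by (simp add: vec_eq_iff split: option.split)
  then show "mcoeff g \<beta> = mcoeff (msum {(m, n). m + n \<ge> 2} (\<lambda>(m, n). in_zw (zw_coeff g m n) * mvar None ^ n)) \<beta>"
    using assms[of \<beta>] by (auto simp: mcoeff_zw_expansion homogeneous_zw_coeff zw_coeff.rep_eq mdeg_zw_z)
qed

lemma normalized_map_iff:
  "normalized_map F G \<longleftrightarrow> normal_map (\<lambda>k. F k - mvar (Some k)) (G - mvar None)"
proof
  assume "normalized_map F G"
  then obtain Fc Gc where hom: "\<And>m n k. homogeneous m (Fc m n k)" "\<And>m n. homogeneous m (Gc m n)"
    and F: "\<And>k. F k = mvar (Some k) + msum {(m, n). m + n \<ge> 2} (\<lambda>(m, n). in_zw (Fc m n k) * mvar None ^ n)"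
    and G: "G = mvar None + msum {(m, n). m + n \<ge> 2} (\<lambda>(m, n). in_zw (Gc m n) * mvar None ^ n)"
    and norm: "\<And>n k. n \<ge> 1 \<Longrightarrow> Fc 0 (n + 1) k = 0 \<and> Fc 1 n k = 0"
    unfolding normalized_map_def by blast
  show "normal_map (\<lambda>k. F k - mvar (Some k)) (G - mvar None)"
    unfolding normal_map_def
  proof (intro conjI allI impI)
    fix k \<beta> assume \<beta>: "zw_zdeg (\<beta> :: nat ^ ('a option)) \<le> 1"
    have "Fc (zw_zdeg \<beta>) (\<beta> $ None) k = 0" if "zw_zdeg \<beta> + \<beta> $ None \<ge> 2"
    proof (cases "zw_zdeg \<beta> = 0")
      case True
      then show ?thesis using norm[of "\<beta> $ None - 1" k] that by simp
    next
      case False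
      then have "zw_zdeg \<beta> = 1" using \<beta> by simp
      then show ?thesis using norm[of "\<beta> $ None" k] that by simp
    qed
    then show "mcoeff (F k - mvar (Some k)) \<beta> = 0"
      by (auto simp: F mcoeff_zw_expansion[OF hom(1)] mcoeff_simps)
  next
    fix \<beta> :: "nat ^ ('a option)" assume "zw_zdeg \<beta> + \<beta> $ None \<le> 1"
    then show "mcoeff (G - mvar None) \<beta> = 0" by (simp add: G mcoeff_zw_expansion[OF hom(2)])
  qed
next
  assume n: "normal_map (\<lambda>k. F k - mvar (Some k)) (G - mvar None)"
  have "zw_coeff (F k - mvar (Some k)) m i = 0" if "m \<le> 1" for k m i
  proof (rule mfps_eqI)
    fix \<gamma> :: "nat ^ 'a"
    have "zw_zdeg (\<chi> v. case v of Some k \<Rightarrow> \<gamma> $ k | None \<Rightarrow> i) = mdeg \<gamma>"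
      by (simp add: zw_zdeg_def wdeg_def)
    then show "mcoeff (zw_coeff (F k - mvar (Some k)) m i) \<gamma> = mcoeff 0 \<gamma>"
      using n that by (simp add: zw_coeff.rep_eq mcoeff_simps(4) normal_map_def)
  qed
  moreover have "F k = mvar (Some k) + msum {(m, n). m + n \<ge> 2}
      (\<lambda>(m, n). in_zw (zw_coeff (F k - mvar (Some k)) m n) * mvar None ^ n)" for k
  proof -
    have "mcoeff (F k - mvar (Some k)) \<beta> = 0" if "zw_zdeg \<beta> + \<beta> $ None \<le> 1" for \<beta>
      using n that by (simp add: normal_map_def)
    from diff_eq_eq[THEN iffD1, OF zw_expansion[OF this]] show ?thesis by (simp only: add.commute)
  qed
  moreover have "G = mvar None + msum {(m, n). m + n \<ge> 2}
      (\<lambda>(m, n). in_zw (zw_coeff (G - mvar None) m n) * mvar None ^ n)"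
  proof -
    have "mcoeff (G - mvar None) \<beta> = 0" if "zw_zdeg \<beta> + \<beta> $ None \<le> 1" for \<beta>
      using n that by (simp add: normal_map_def)
    from diff_eq_eq[THEN iffD1, OF zw_expansion[OF this]] show ?thesis by (simp only: add.commute)
  qed
  ultimately show "normalized_map F G"
    unfolding normalized_map_def
    by (intro exI[of _ "\<lambda>m n k. zw_coeff (F k - mvar (Some k)) m n"] exI[of _ "zw_coeff (G - mvar None)"]
          conjI allI impI homogeneous_zw_coeff) (assumption | simp)+
qed

lemma bihom_part_msum:
  assumes "\<And>m n. bihomogeneous m n (\<phi> m n)"
  shows "bihom_part m n (msum I (\<lambda>(m, n). \<phi> m n)) = (if (m, n) \<in> I then \<phi> m n else 0)"
proof (rule mfps_eqI)
  fix \<alpha> :: "nat ^ ('a + 'a)"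
  have 0: "mcoeff (\<phi> i j) \<alpha> = 0" if "zdeg \<alpha> \<noteq> i \<or> zbardeg \<alpha> \<noteq> j" for i j
    using mcoeff_bihomogeneous_eq_0[OF assms] that .
  have "mcoeff (msum I (\<lambda>(m, n). \<phi> m n)) \<alpha> =
      (if (zdeg \<alpha>, zbardeg \<alpha>) \<in> I then mcoeff (\<phi> (zdeg \<alpha>) (zbardeg \<alpha>)) \<alpha> else 0)"
    by (subst mcoeff_msum_single[where j = "(zdeg \<alpha>, zbardeg \<alpha>)"]) (auto intro: 0)
  then show "mcoeff (bihom_part m n (msum I (\<lambda>(m, n). \<phi> m n))) \<alpha> = mcoeff (if (m, n) \<in> I then \<phi> m n else 0) \<alpha>"
    using 0[of m n] by (auto simp: bihom_part.rep_eq mcoeff_simps(4))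
qed

lemma bihom_part_msum_z:
  assumes "\<And>m n. bihomogeneous m n (\<phi> m n)"
  shows "bihom_part m n (msum I (\<lambda>k. \<phi> k 0)) = (if m \<in> I \<and> n = 0 then \<phi> m 0 else 0)"
proof (rule mfps_eqI)
  fix \<alpha> :: "nat ^ ('a + 'a)"
  have 0: "mcoeff (\<phi> i 0) \<alpha> = 0" if "zdeg \<alpha> \<noteq> i \<or> zbardeg \<alpha> \<noteq> 0" for i
    using mcoeff_bihomogeneous_eq_0[OF assms] that .
  have "mcoeff (msum I (\<lambda>k. \<phi> k 0)) \<alpha> = (if zdeg \<alpha> \<in> I then mcoeff (\<phi> (zdeg \<alpha>) 0) \<alpha> else 0)"
    by (rule mcoeff_msum_single) (rule 0, blast)
  then show "mcoeff (bihom_part m n (msum I (\<lambda>k. \<phi> k 0))) \<alpha> = mcoeff (if m \<in> I \<and> n = 0 then \<phi> m 0 else 0) \<alpha>"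
    using 0[of m] by (cases "zdeg \<alpha> = m"; cases "zbardeg \<alpha> = n"; cases "n = 0")
      (simp_all add: bihom_part.rep_eq mcoeff_simps(4))
qed

lemma two_mult_mRe: "2 * mRe f = f + mconj f"
proof -
  have "2 * mRe f = mconst (1 / 2 + 1 / 2) * (f + mconj f)"
    unfolding mult_2 mRe_def mconst_add distrib_right[of "mconst _" "mconst _"] ..
  also have "(1 / 2 + 1 / 2 :: complex) = 1" by simp
  finally show ?thesis by (simp only: mconst_1 mult_1)
qed

text \<open>Doubling the real part adds to the holomorphic terms their conjugates, in bidegrees \<open>(0, n)\<close>.\<close>
lemma bihom_part_normal_form_expansion:
  assumes "\<And>m n. bihomogeneous m n (\<phi> m n)"
  shows "bihom_part m n (msum {(m, n). m + n \<ge> 3 \<and> m \<noteq> 0 \<and> n \<noteq> 0} (\<lambda>(m, n). \<phi> m n)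
      + 2 * mRe (msum {3..} (\<lambda>k. \<phi> k 0))) =
    (if m + n < 3 then 0 else if m = 0 then mconj (\<phi> n 0) else \<phi> m n)"
  by (auto simp: two_mult_mRe bihom_part_add bihom_part_mconj bihom_part_msum[OF assms] bihom_part_msum_z[OF assms] mconj_0)

lemma partial_normal_form_iff:
  fixes \<rho>' :: "'n::finite zzbar_series"
  shows "partial_normal_form \<rho>' \<longleftrightarrow> normal_form (\<rho>' - herm)"
  unfolding partial_normal_form_def
proof (intro iffI; (elim exE conjE)?)
  fix \<phi> :: "nat \<Rightarrow> nat \<Rightarrow> 'n zzbar_series"
  assume hom: "\<forall>m n. bihomogeneous m n (\<phi> m n)"
    and \<rho>': "\<rho>' = herm + msum {(m, n). m + n \<ge> 3 \<and> m \<noteq> 0 \<and> n \<noteq> 0} (\<lambda>(m, n). \<phi> m n)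
               + 2 * mRe (msum {3..} (\<lambda>k. \<phi> k 0))"
    and tr: "\<forall>m n. m \<noteq> 0 \<and> n \<noteq> 0 \<and> m \<le> n - 1 \<longrightarrow> (tr ^^ (m - 1)) (\<phi> m n) = 0"
      "\<forall>m n. m \<noteq> 0 \<and> n \<noteq> 0 \<and> m \<ge> n \<longrightarrow> (tr ^^ n) (\<phi> m n) = 0"
  have part: "bihom_part m n (\<rho>' - herm) = (if m + n < 3 then 0 else if m = 0 then mconj (\<phi> n 0) else \<phi> m n)" for m n
    unfolding \<rho>' add.assoc add_diff_cancel_left' using hom by (intro bihom_part_normal_form_expansion) blast
  show "normal_form (\<rho>' - herm)"
    unfolding normal_form_def ord_ge_iff_bihom_part part
  proof (intro conjI allI impI)
    fix m n :: nat assume "1 \<le> m \<and> m < n"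
    then have "m \<noteq> 0 \<and> n \<noteq> 0 \<and> m \<le> n - 1" by auto
    then show "(tr ^^ (m - 1)) (if m + n < 3 then 0 else if m = 0 then mconj (\<phi> n 0) else \<phi> m n) = 0"
      using tr(1)[rule_format, of m n] by (simp add: funpow_tr_0)
  next
    fix m n :: nat assume "1 \<le> n \<and> n \<le> m"
    then show "(tr ^^ n) (if m + n < 3 then 0 else if m = 0 then mconj (\<phi> n 0) else \<phi> m n) = 0"
      using tr(2)[rule_format, of m n] by (simp add: funpow_tr_0)
  qed (simp_all add: mconj_0)
next
  assume n: "normal_form (\<rho>' - herm)"
  define \<phi> where "\<phi> m n = bihom_part m n (\<rho>' - herm)" for m n
  have hom: "bihomogeneous m n (\<phi> m n)" for m n by (simp add: \<phi>_def)
  have "\<rho>' - herm = msum {(m, n). m + n \<ge> 3 \<and> m \<noteq> 0 \<and> n \<noteq> 0} (\<lambda>(m, n). \<phi> m n)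
               + 2 * mRe (msum {3..} (\<lambda>k. \<phi> k 0))"
  proof (rule mfps_eqI_bihom_part)
    fix i j
    show "bihom_part i j (\<rho>' - herm) = bihom_part i j (msum {(m, n). m + n \<ge> 3 \<and> m \<noteq> 0 \<and> n \<noteq> 0} (\<lambda>(m, n). \<phi> m n)
               + 2 * mRe (msum {3..} (\<lambda>k. \<phi> k 0)))"
      unfolding bihom_part_normal_form_expansion[OF hom]
      unfolding \<phi>_def using normal_formD(1)[OF n, unfolded ord_ge_iff_bihom_part, rule_format, of i j]
        normal_formD(4)[OF n, of j]
      by (cases "i = 0"; cases "i + j < 3") simp_all
  qed
  then have \<rho>': "\<rho>' = herm + msum {(m, n). m + n \<ge> 3 \<and> m \<noteq> 0 \<and> n \<noteq> 0} (\<lambda>(m, n). \<phi> m n)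
               + 2 * mRe (msum {3..} (\<lambda>k. \<phi> k 0))"
    by (simp only: diff_eq_eq ac_simps)
  show "\<exists>\<phi>'. (\<forall>m n. bihomogeneous m n (\<phi>' m n)) \<and>
      \<rho>' = herm + msum {(m, n). m + n \<ge> 3 \<and> m \<noteq> 0 \<and> n \<noteq> 0} (\<lambda>(m, n). \<phi>' m n)
               + 2 * mRe (msum {3..} (\<lambda>k. \<phi>' k 0)) \<and>
      (\<forall>m n. m \<noteq> 0 \<and> n \<noteq> 0 \<and> m \<le> n - 1 \<longrightarrow> (tr ^^ (m - 1)) (\<phi>' m n) = 0) \<and>
      (\<forall>m n. m \<noteq> 0 \<and> n \<noteq> 0 \<and> m \<ge> n \<longrightarrow> (tr ^^ n) (\<phi>' m n) = 0)"
  proof (intro exI[of _ \<phi>] conjI allI impI hom \<rho>')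
    fix m k :: nat assume "m \<noteq> 0 \<and> k \<noteq> 0 \<and> m \<le> k - 1"
    then show "(tr ^^ (m - 1)) (\<phi> m k) = 0"
      unfolding \<phi>_def by (intro normal_formD(2)[OF n]) auto
  next
    fix m k :: nat assume "m \<noteq> 0 \<and> k \<noteq> 0 \<and> m \<ge> k"
    then show "(tr ^^ k) (\<phi> m k) = 0"
      unfolding \<phi>_def by (intro normal_formD(3)[OF n]) auto
  qed
qed

section \<open>The nonlinear transformation problem\<close>

text \<open>The series \<open>(F(z, \<rho>), conj (F(z, \<rho>)))\<close> for \<open>F = z + f\<close>, to be substituted for \<open>(z, conj z)\<close> in \<open>\<rho>'\<close>.\<close>
definition transformed_var :: "('n::finite \<Rightarrow> 'n zw_series) \<Rightarrow> 'n zzbar_series \<Rightarrow> 'n + 'n \<Rightarrow> 'n zzbar_series" where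
  "transformed_var f \<rho> v = (case v of Inl k \<Rightarrow> mvar (Inl k) + restrict_to (f k) \<rho>
     | Inr k \<Rightarrow> mvar (Inr k) + mconj (restrict_to (f k) \<rho>))"

text \<open>What is left of the transformation equation after its linear part.  Each summand gains one order: the
  first and the two pairings because \<open>\<rho>\<close> agrees with \<open>\<langle>z, z\<rangle>\<close> up to order 3, the second because the change of variables is the
  identity up to order 2, the sum because it is quadratic in \<open>f\<close>; the last summand is a constant.\<close>
definition remainder ::
  "'n::finite zzbar_series \<Rightarrow> ('n \<Rightarrow> 'n zw_series) \<Rightarrow> 'n zw_series \<Rightarrow> 'n zzbar_series \<Rightarrow> 'n zzbar_series" where
  "remainder \<rho> f g p =
     (restrict_to g herm - restrict_to g \<rho>)
     + (msubst p (transformed_var f \<rho>) - p)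
     + (herm_pairing f \<rho> - herm_pairing f herm) + mconj (herm_pairing f \<rho> - herm_pairing f herm)
     + (\<Sum>k\<in>UNIV. restrict_to (f k) \<rho> * mconj (restrict_to (f k) \<rho>))
     - (\<rho> - herm)"

lemma ord_ge_transformed_var:
  assumes "\<And>k. order_ge zw_weight 2 (f k)" "ord_ge 2 \<rho>"
  shows "ord_ge 1 (transformed_var f \<rho> v)"
proof -
  have "ord_ge 1 (restrict_to (f k) \<rho>)" for k
    by (rule order_ge_mono[OF ord_ge_restrict_to[OF assms(1) assms(2)]]) simp
  then show ?thesis
    by (auto simp: transformed_var_def split: sum.split intro!: order_ge_add ord_ge_mvar ord_ge_mconj)
qed

text \<open>Expanding \<open>\<langle>z + f, z + f\<rangle>\<close> makes the equation a sum whose terms only have to be regrouped.\<close>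
lemma transforms_iff_linear_part_eq_remainder:
  fixes \<rho> :: "'n::finite zzbar_series"
  assumes fg: "normal_map f g" and \<rho>: "ord_ge 2 \<rho>"
  shows "transforms (\<lambda>k. mvar (Some k) + f k) (mvar None + g) \<rho> (herm + p) \<longleftrightarrow> linear_part f g p = remainder \<rho> f g p"
proof -
  let ?E = "\<lambda>k. restrict_to (f k) \<rho>"
  have mvar: "restrict_to (mvar (Some k)) \<rho> = mvar (Inl k)" "restrict_to (mvar None) \<rho> = \<rho>" for k
    unfolding restrict_to_def by (simp_all add: msubst_mvar[OF ord_ge_1_restrict[OF \<rho>]])
  have \<zeta>: "(\<lambda>v. case v of Inl k \<Rightarrow> restrict_to (mvar (Some k) + f k) \<rho>
      | Inr k \<Rightarrow> mconj (restrict_to (mvar (Some k) + f k) \<rho>)) = transformed_var f \<rho>"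
    by (auto simp: fun_eq_iff transformed_var_def restrict_to_add[OF \<rho>] mvar mconj_add mconj_mvar split: sum.split)
  have 0: "mcoeff (mvar (Some k) + f k) 0 = 0" "mcoeff (mvar None + g) 0 = 0" for k
    using fg by (simp_all add: normal_map_def mcoeff_simps zw_zdeg_def mvar.rep_eq vec_eq_iff axis_def)
  have ord: "ord_ge 1 (transformed_var f \<rho> v)" for v
    by (intro ord_ge_transformed_var normal_map_order(1)[OF fg] \<rho>)
  have "msubst herm (transformed_var f \<rho>) = (\<Sum>k\<in>UNIV. transformed_var f \<rho> (Inl k) * transformed_var f \<rho> (Inr k))"
    unfolding herm_def by (simp add: msubst_sum[OF ord] msubst_mvar_mult_mvar[OF ord])
  also have "\<dots> = herm + herm_pairing f \<rho> + mconj (herm_pairing f \<rho>) + (\<Sum>k\<in>UNIV. ?E k * mconj (?E k))"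
    by (simp add: transformed_var_def herm_def herm_pairing_def mconj_sum mconj_mult mconj_mvar
        distrib_left distrib_right sum.distrib ac_simps)
  finally have "msubst (herm + p) (transformed_var f \<rho>) =
      herm + herm_pairing f \<rho> + mconj (herm_pairing f \<rho>) + (\<Sum>k\<in>UNIV. ?E k * mconj (?E k))
      + msubst p (transformed_var f \<rho>)"
    by (simp add: msubst_add[OF ord])
  then have "transforms (\<lambda>k. mvar (Some k) + f k) (mvar None + g) \<rho> (herm + p) \<longleftrightarrow>
    \<rho> + restrict_to g \<rho> = herm + herm_pairing f \<rho> + mconj (herm_pairing f \<rho>)
      + (\<Sum>k\<in>UNIV. ?E k * mconj (?E k)) + msubst p (transformed_var f \<rho>)"
    unfolding transforms_def \<zeta> by (simp add: 0 restrict_to_add[OF \<rho>] mvar)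
  also have "\<dots> \<longleftrightarrow> linear_part f g p = remainder \<rho> f g p"
    unfolding linear_part_def remainder_def mconj_diff by (auto simp: algebra_simps)
  finally show ?thesis .
qed

text \<open>As in lemma \<open>linear_part_injective\<close>, the orders of \<open>f\<close> lag by one; in every term the remaining factors make up for it.\<close>
lemma remainder_contraction:
  fixes \<rho> :: "'n::finite zzbar_series"
  assumes fg: "normal_map f g" "normal_map f' g'" and p: "ord_ge 3 p'"
    and \<rho>: "ord_ge 3 (\<rho> - herm)"
    and f: "\<And>k. order_ge zw_weight (T - 1) (f k - f' k)"
    and g: "order_ge zw_weight T (g - g')" and T: "ord_ge T (p - p')"
  shows "ord_ge (T + 1) (remainder \<rho> f g p - remainder \<rho> f' g' p')"
proof -
  have \<rho>2: "ord_ge 2 \<rho>"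
    using order_ge_add[OF order_ge_mono[OF \<rho>, of 2] ord_ge_herm] by simp
  have cl: "close 1 2 \<rho> herm" using \<rho>2 ord_ge_herm \<rho> by (simp add: close_def)
  let ?E = "\<lambda>f k. restrict_to (f k) \<rho>" and ?\<zeta> = "\<lambda>f. transformed_var f \<rho>"
  let ?P = "\<lambda>f. herm_pairing f \<rho> - herm_pairing f herm"
  have E: "ord_ge 2 (?E f k)" "ord_ge 2 (?E f' k)" "ord_ge (T - 1) (?E f k - ?E f' k)" for k
    using ord_ge_restrict_to[OF normal_map_order(1)[OF fg(1)] \<rho>2]
      ord_ge_restrict_to[OF normal_map_order(1)[OF fg(2)] \<rho>2]
      ord_ge_restrict_to[OF f \<rho>2] by (simp_all add: restrict_to_diff[OF \<rho>2])
  have \<zeta>: "ord_ge 1 (?\<zeta> f v)" "ord_ge 1 (?\<zeta> f' v)" for v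
    by (intro ord_ge_transformed_var normal_map_order(1)[OF fg(1)] normal_map_order(1)[OF fg(2)] \<rho>2)+
  have 1: "ord_ge (T + 1) ((restrict_to g herm - restrict_to g \<rho>) - (restrict_to g' herm - restrict_to g' \<rho>))"
  proof -
    have "ord_ge (T + 1) (restrict_to (g - g') \<rho> - restrict_to (g - g') herm)"
      using restrict_to_close[OF g cl] by (simp add: close_def)
    from order_ge_uminus[OF this] show ?thesis
      by (simp add: restrict_to_diff \<rho>2 ord_ge_herm algebra_simps)
  qed
  \<comment> \<open>Change \<open>p\<close> with the substitution fixed, then the substitution with \<open>p'\<close> fixed; in the latter step the order 3
    of \<open>p'\<close> contributes two factors of order 1 beside the difference of the variables.\<close>
  have 2: "ord_ge (T + 1) ((msubst p (?\<zeta> f) - p) - (msubst p' (?\<zeta> f') - p'))"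
  proof -
    have "close 1 1 (?\<zeta> f v) (mvar v)" for v
      using \<zeta>(1)[of v] ord_ge_mvar E(1) ord_ge_mconj[OF E(1)]
      by (auto simp: close_def transformed_var_def split: sum.split)
    then have "close 1 T (msubst (p - p') (?\<zeta> f)) (msubst (p - p') mvar)"
      using T by (intro msubst_close[where \<omega> = "\<lambda>_. 1"]) simp_all
    then have a: "ord_ge (T + 1) (msubst p (?\<zeta> f) - msubst p' (?\<zeta> f) - (p - p'))"
      by (simp add: close_def msubst_mvar_id msubst_diff \<zeta>)
    have "close (T - 2) 1 (?\<zeta> f v) (?\<zeta> f' v)" for v
    proof -
      have "ord_ge (1 + (T - 2)) (?\<zeta> f v - ?\<zeta> f' v)"
      proof (cases "T \<ge> 2")
        case True
        then have "1 + (T - 2) = T - 1" by simp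
        then show ?thesis using E(3) ord_ge_mconj[OF E(3)]
          by (auto simp: transformed_var_def mconj_diff split: sum.split)
      next
        case False
        then have "1 + (T - 2) = 1" by simp
        then show ?thesis using order_ge_diff[OF \<zeta>] by simp
      qed
      then show ?thesis using \<zeta> by (simp add: close_def)
    qed
    then have "close (T - 2) 3 (msubst p' (?\<zeta> f)) (msubst p' (?\<zeta> f'))"
      using p by (intro msubst_close[where \<omega> = "\<lambda>_. 1"]) simp_all
    then have "ord_ge (T + 1) (msubst p' (?\<zeta> f) - msubst p' (?\<zeta> f'))"
      unfolding close_def by (elim conjE order_ge_mono) simp
    from order_ge_add[OF a this] show ?thesis by (simp add: algebra_simps)
  qed
  have 3: "ord_ge (T + 1) (?P f - ?P f')"
  proof -
    have "ord_ge (T - 1 + 1) (restrict_to (f k - f' k) \<rho> - restrict_to (f k - f' k) herm)" for k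
      using restrict_to_close[OF f cl] by (simp add: close_def)
    then have "ord_ge (T - 1 + 1 + 1) (\<Sum>k\<in>UNIV. (restrict_to (f k - f' k) \<rho> - restrict_to (f k - f' k) herm) * mvar (Inr k))"
      by (intro order_ge_sum order_ge_mult ord_ge_mvar)
    then have "ord_ge (T + 1) (herm_pairing (\<lambda>k. f k - f' k) \<rho> - herm_pairing (\<lambda>k. f k - f' k) herm)"
      unfolding herm_pairing_def sum_subtractf[symmetric] left_diff_distrib
      by (rule order_ge_mono) simp
    then show ?thesis by (simp add: herm_pairing_diff \<rho>2 ord_ge_herm algebra_simps)
  qed
  have 4: "ord_ge (T + 1) ((\<Sum>k\<in>UNIV. ?E f k * mconj (?E f k)) - (\<Sum>k\<in>UNIV. ?E f' k * mconj (?E f' k)))"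
    unfolding sum_subtractf[symmetric]
  proof (rule order_ge_sum)
    fix k
    have "?E f k * mconj (?E f k) - ?E f' k * mconj (?E f' k) =
        (?E f k - ?E f' k) * mconj (?E f k) + mconj (?E f k - ?E f' k) * ?E f' k"
      by (simp add: mconj_diff algebra_simps)
    moreover have "ord_ge (T - 1 + 2) \<dots>"
      by (intro order_ge_add order_ge_mult E ord_ge_mconj)
    ultimately show "ord_ge (T + 1) (?E f k * mconj (?E f k) - ?E f' k * mconj (?E f' k))"
      by (simp only:) (erule order_ge_mono, simp)
  qed
  have "remainder \<rho> f g p - remainder \<rho> f' g' p' =
      ((restrict_to g herm - restrict_to g \<rho>) - (restrict_to g' herm - restrict_to g' \<rho>))
    + ((msubst p (?\<zeta> f) - p) - (msubst p' (?\<zeta> f') - p'))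
    + (?P f - ?P f') + mconj (?P f - ?P f')
    + ((\<Sum>k\<in>UNIV. ?E f k * mconj (?E f k)) - (\<Sum>k\<in>UNIV. ?E f' k * mconj (?E f' k)))"
    unfolding remainder_def mconj_diff by (simp add: algebra_simps)
  then show ?thesis
    using 1 2 3 4 ord_ge_mconj[OF 3] by (simp only: order_ge_add)
qed

text \<open>The difference of the two linear parts is the difference of the remainders; if it has order \<open>T\<close>, then
  injectivity gives agreement of the triples up to order \<open>T\<close>, and contraction raises the order to \<open>T + 1\<close>.\<close>
lemma normalizing_map_unique:
  assumes \<rho>: "ord_ge 3 (\<rho> - herm)"
    and u: "normal_map f g" "normal_form p" "linear_part f g p = remainder \<rho> f g p"
    and u': "normal_map f' g'" "normal_form p'" "linear_part f' g' p' = remainder \<rho> f' g' p'"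
  shows "f = f'" "g = g'"
proof -
  let ?d = "linear_part f g p - linear_part f' g' p'"
  have inj: "order_ge zw_weight (T - 1) (f k - f' k)" "order_ge zw_weight T (g - g')" "ord_ge T (p - p')"
    if "ord_ge T ?d" for T k
    using linear_part_injective[OF normal_map_diff[OF u(1) u'(1)] normal_form_diff[OF u(2) u'(2)], of T] that
    unfolding linear_part_diff by blast+
  have d: "ord_ge T ?d" for T
  proof (induction T)
    case (Suc T)
    have "ord_ge (T + 1) (remainder \<rho> f g p - remainder \<rho> f' g' p')"
      by (rule remainder_contraction[OF u(1) u'(1) normal_formD(1)[OF u'(2)] \<rho> inj[OF Suc]])
    then show ?case unfolding u(3) u'(3) Suc_eq_plus1 .
  qed simp
  have "order_ge zw_weight T (f k - f' k)" for T k
    using inj(1)[OF d, of "T + 1"] by simp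
  then show "f = f'" by (intro ext ord_ge_all_imp_eq)
  show "g = g'" using inj(2)[OF d] by (rule ord_ge_all_imp_eq)
qed

text \<open>The unknown is the common value \<open>H\<close> of both sides of the equation: choosing a preimage of \<open>H\<close> under the linear
  part and taking its remainder is a contraction of the series of order at least 3.\<close>
lemma normalizing_map_exists:
  fixes \<rho> :: "'n::finite zzbar_series"
  assumes \<rho>: "ord_ge 3 (\<rho> - herm)"
  shows "\<exists>f g p. normal_map f g \<and> normal_form p \<and> linear_part f g p = remainder \<rho> f g p"
proof -
  obtain f g p where S: "\<And>H :: 'n zzbar_series. ord_ge 3 H \<Longrightarrow>
      normal_map (f H) (g H) \<and> normal_form (p H) \<and> linear_part (f H) (g H) (p H) = H"
    using linear_part_surjective by metis
  then have S_map: "normal_map (f H) (g H)" and S_form: "normal_form (p H)"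
    and S_lin: "linear_part (f H) (g H) (p H) = H" if "ord_ge 3 H" for H
    using that by simp_all
  define \<Phi> where "\<Phi> H = remainder \<rho> (f H) (g H) (p H)" for H
  have contr: "ord_ge (T + 1) (\<Phi> H - \<Phi> H')"
    if H: "ord_ge 3 H" "ord_ge 3 H'" "ord_ge T (H - H')" for T H H'
    unfolding \<Phi>_def
  proof (rule remainder_contraction[OF _ _ _ \<rho>])
    have T: "ord_ge T (linear_part (\<lambda>k. f H k - f H' k) (g H - g H') (p H - p H'))"
      unfolding linear_part_diff S_lin[OF H(1)] S_lin[OF H(2)] by (rule H(3))
    have n: "normal_map (\<lambda>k. f H k - f H' k) (g H - g H')" "normal_form (p H - p H')"
      by (intro normal_map_diff normal_form_diff S_map S_form H(1,2))+
    show "order_ge zw_weight (T - 1) (f H k - f H' k)" "order_ge zw_weight T (g H - g H')"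
      "ord_ge T (p H - p H')" for k
      by (rule linear_part_injective[OF n T])+
    show "normal_map (f H) (g H)" "normal_map (f H') (g H')" "ord_ge 3 (p H')"
      by (intro normal_formD(1) S_map S_form H(1,2))+
  qed
  have ord: "ord_ge 3 (\<Phi> H)" if H: "ord_ge 3 H" for H
  proof -
    \<comment> \<open>Compare with the zero triple, whose remainder is \<open>\<langle>z, z\<rangle> - \<rho>\<close>.\<close>
    have 0: "normal_map (\<lambda>_. 0) (0 :: 'n zw_series)" by (simp add: normal_map_def mcoeff_simps)
    have r: "restrict_to 0 \<sigma> = 0" if "ord_ge 2 \<sigma>" for \<sigma> :: "'n zzbar_series"
      using restrict_to_diff[OF that, of 0 0] by simp
    have \<rho>2: "ord_ge 2 \<rho>"
      using order_ge_add[OF order_ge_mono[OF \<rho>, of 2] ord_ge_herm] by simp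
    have "msubst 0 (transformed_var (\<lambda>_. 0) \<rho>) = 0"
      using msubst_diff[OF ord_ge_transformed_var[OF _ \<rho>2, of "\<lambda>_. 0"], of 0 0] by simp
    then have rem0: "remainder \<rho> (\<lambda>_. 0) 0 0 = - (\<rho> - herm)"
      by (simp add: remainder_def herm_pairing_def r \<rho>2 ord_ge_herm mconj_0)
    have "ord_ge (2 + 1) (\<Phi> H - remainder \<rho> (\<lambda>_. 0) 0 0)"
      unfolding \<Phi>_def
    proof (rule remainder_contraction[OF _ 0 _ \<rho>])
      show "normal_map (f H) (g H)" by (rule S_map[OF H])
      have "ord_ge 3 (p H)" by (rule normal_formD(1)[OF S_form[OF H]])
      then show "ord_ge 2 (p H - 0)" using order_ge_mono[of _ 3 "p H" 2] by simp
      show "order_ge zw_weight (2 - 1) (f H k - 0)" for k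
        using order_ge_mono[OF normal_map_order(1)[OF S_map[OF H]], of "2 - 1"] by simp
      show "order_ge zw_weight 2 (g H - 0)" using normal_map_order(2)[OF S_map[OF H]] by simp
    qed simp
    then have "ord_ge 3 (\<Phi> H - remainder \<rho> (\<lambda>_. 0) 0 0)" by simp
    from order_ge_diff[OF this \<rho>] show ?thesis unfolding rem0 by simp
  qed
  have "\<exists>H. ord_ge 3 H \<and> \<Phi> H = H"
    by (rule contraction_fixed_point) (rule ord contr; assumption)+
  then obtain H where H: "ord_ge 3 H \<and> \<Phi> H = H" ..
  then have "linear_part (f H) (g H) (p H) = remainder \<rho> (f H) (g H) (p H)"
    unfolding \<Phi>_def by (simp only: S_lin)
  then show ?thesis using H S_map S_form by blast
qed

section \<open>Existence and uniqueness of the normalizing map\<close>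

theorem theorem2p2:
  fixes \<rho> :: "'n::finite zzbar_series"
    and \<phi> :: "nat \<Rightarrow> nat \<Rightarrow> 'n zzbar_series"
  assumes "CR_singular_at_origin \<rho>"
    and "\<And>m n. bihomogeneous m n (\<phi> m n)"
    and "\<rho> = herm + msum {(m, n). m + n \<ge> 3} (\<lambda>(m, n). \<phi> m n)"
  shows "\<exists>!(F, G). normalized_map F G \<and> (\<exists>\<rho>'. partial_normal_form \<rho>' \<and> transforms F G \<rho> \<rho>')"
proof -
  have \<rho>: "ord_ge 3 (\<rho> - herm)"
    unfolding ord_ge_iff_bihom_part assms(3) by (simp add: bihom_part_msum[OF assms(2)])
  have \<rho>2: "ord_ge 2 \<rho>"
    using order_ge_add[OF order_ge_mono[OF \<rho>, of 2] ord_ge_herm] by simp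
  let ?good = "\<lambda>F G. normalized_map F G \<and> (\<exists>\<rho>'. partial_normal_form \<rho>' \<and> transforms F G \<rho> \<rho>')"
  have good: "\<exists>p. normal_map (\<lambda>k. F k - mvar (Some k)) (G - mvar None) \<and> normal_form p \<and>
      linear_part (\<lambda>k. F k - mvar (Some k)) (G - mvar None) p =
      remainder \<rho> (\<lambda>k. F k - mvar (Some k)) (G - mvar None) p" if "?good F G" for F G
  proof -
    from that obtain \<rho>' where *: "normal_map (\<lambda>k. F k - mvar (Some k)) (G - mvar None)"
      "normal_form (\<rho>' - herm)" "transforms F G \<rho> \<rho>'"
      by (auto simp: normalized_map_iff partial_normal_form_iff)
    then show ?thesis
      using transforms_iff_linear_part_eq_remainder[OF *(1) \<rho>2, of "\<rho>' - herm"] by auto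
  qed
  obtain f g p where fgp: "normal_map f g" "normal_form p" "linear_part f g p = remainder \<rho> f g p"
    using normalizing_map_exists[OF \<rho>] by blast
  let ?F = "\<lambda>k. mvar (Some k) + f k" and ?G = "mvar None + g"
  show ?thesis
  proof (rule ex1I[of _ "(?F, ?G)"])
    show "case (?F, ?G) of (F, G) \<Rightarrow> ?good F G"
      using fgp transforms_iff_linear_part_eq_remainder[OF fgp(1) \<rho>2, of p]
      by (auto simp: normalized_map_iff partial_normal_form_iff intro!: exI[of _ "herm + p"])
  next
    fix x assume "case x of (F, G) \<Rightarrow> ?good F G"
    then obtain F G where x: "x = (F, G)" and FG: "?good F G" by (cases x) auto
    from good[OF FG] obtain p' where p': "normal_map (\<lambda>k. F k - mvar (Some k)) (G - mvar None)"
      "normal_form p'" "linear_part (\<lambda>k. F k - mvar (Some k)) (G - mvar None) p' =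
      remainder \<rho> (\<lambda>k. F k - mvar (Some k)) (G - mvar None) p'" by blast
    have "f = (\<lambda>k. F k - mvar (Some k))" "g = G - mvar None"
      using normalizing_map_unique[OF \<rho> fgp p'] by blast+
    then show "x = (?F, ?G)" by (simp add: x)
  qed
qed

end
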